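(* Let $A,B$ be real symmetric $4\times 4$ matrices defining quadrics $\mathcal A: X^TAX=0$, $\mathcal B: X^TBX=0$ in $\mathbb{PR}^3$ with $f(\lambda)=\det(\lambda A-B)$ not identically zero. Suppose $f(\lambda)=0$ has one double real root and two other distinct real roots, with Segre characteristic $[211]$. Then, up to equivalence, the only possible index sequences of the pencil are $\langle 2\,{\wr\wr}_{-}\,2|3|2\rangle$, $\langle 2\,{\wr\wr}_{+}\,2|3|2\rangle$, $\langle 1\,{\wr\wr}_{-}\,1|2|3\rangle$ and $\langle 1\,{\wr\wr}_{+}\,1|2|3\rangle$. Furthermore: (1) if the index sequence is $\langle 2\,{\wr\wr}_{-}\,2|3|2\rangle$ or $\langle 2\,{\wr\wr}_{+}\,2|3|2\rangle$, the QSIC has one closed component with a crunode; (2) if the index sequence is $\langle 1\,{\wr\wr}_{-}\,1|2|3\rangle$, the QSIC has a closed component plus an acnode; (3) if the index sequence is $\langle 1\,{\wr\wr}_{+}\,1|2|3\rangle$, the QSIC has only one real point, which is an acnode.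
   Context: $X=(x,y,z,w)^T$ homogeneous coordinates; the QSIC is $\mathcal A\cap\mathcal B$. One may choose the basis of the pencil with $A$ nonsingular (this changes neither the QSIC nor the root structure). Canonical form: for $A$ nonsingular there is a real invertible $Q$ with $Q^TAQ=\mathrm{diag}(\varepsilon_1E_1,\dots,\varepsilon_rE_r,E_{r+1},\dots,E_m)$, $Q^TBQ=\mathrm{diag}(\varepsilon_1E_1J_1,\dots,\varepsilon_rE_rJ_r,E_{r+1}J_{r+1},\dots,E_mJ_m)$, where $J_1,\dots,J_r$ are the real Jordan blocks (eigenvalue on diagonal, $1$ on superdiagonal) of $A^{-1}B$ for real eigenvalues, $J_{r+1},\dots,J_m$ its real Jordan blocks for non-real eigenvalues, $E_i$ the anti-identity matrix of the size of $J_i$, and $\varepsilon_i\in\{\pm1\}$ uniquely determined (for each set of identical blocks); $\varepsilon_i$ is the sign of $J_i$. Segre characteristic: sizes of the Jordan blocks of $A^{-1}B$ for all eigenvalues, blocks of a common eigenvalue grouped in parentheses; $[211]$ means one eigenvalue with a single $2\times2$ block and two eigenvalues with $1\times1$ blocks. $\mathrm{Id}(\lambda)$ = number of positive eigenvalues of $\lambda A-B$. Index sequence: with distinct real roots $\lambda_1<\dots<\lambda_r$, $s_0,\dots,s_r$ the values of $\mathrm{Id}$ on $(-\infty,\lambda_1),(\lambda_1,\lambda_2),\dots,(\lambda_r,\infty)$, the sequence is $\langle s_0\sigma_1s_1\cdots\sigma_rs_r\rangle$ where $\sigma_j$ encodes the Jordan blocks of $\lambda_j$ (larger first): a $1\times1$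 block gives $|$, a $p\times p$ block ($p\ge2$) gives $p$ copies of $\wr$ with subscript equal to the sign ($+$ or $-$) of that block. Sequences are taken up to the equivalence induced by changing the basis of the pencil (keeping the first matrix nonsingular); on numbers this is generated by rotation $\langle s_0\sigma_1s_1\cdots\sigma_rs_r\rangle\sim\langle 4-s_{r-1}\sigma_rs_0\sigma_1\cdots\sigma_{r-1}s_{r-1}\rangle$, reversal, and complement $s_j\mapsto4-s_j$ (from $(A,B)\mapsto(-A,-B)$, which also reverses all sign subscripts). A real component is closed if some real plane misses it, open otherwise. A crunode is a real double point with two real branches; an acnode is an isolated real double point. *)

theory Defs
  imports "Jordan_Normal_Form.Jordan_Normal_Form" "HOL-Analysis.Analysis"
begin

definition pencil_poly :: "real mat \<Rightarrow> real mat \<Rightarrow> real poly" where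
  "pencil_poly A B = Determinant.det
     (Matrix.mat 4 4 (\<lambda>(i,j). [: - (B $$ (i,j)), A $$ (i,j) :]))"

definition pos_eigs :: "real mat \<Rightarrow> nat" where
  "pos_eigs M = (\<Sum>\<mu>\<in>{\<mu>::real. \<mu> > 0 \<and> poly (char_poly M) \<mu> = 0}. order \<mu> (char_poly M))"

definition Idx :: "real mat \<Rightarrow> real mat \<Rightarrow> real \<Rightarrow> nat" where
  "Idx A B l = pos_eigs (l \<cdot>\<^sub>m A - B)"

text \<open>Q^T A Q = diag(e1 E_2, e2, e3), Q^T B Q = diag(e1 E_2 J_2(a), e2 b, e3 c),
  where E_2 J_2(a) = [[0,a],[a,1]].\<close>

definition canon211 :: "real mat \<Rightarrow> real mat \<Rightarrow> real \<Rightarrow> real \<Rightarrow> real \<Rightarrow> real \<Rightarrow> real \<Rightarrow> real \<Rightarrow> bool" where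
  "canon211 A B a b c e1 e2 e3 \<longleftrightarrow>
     (\<exists>Q. Q \<in> carrier_mat 4 4 \<and> invertible_mat Q \<and>
       transpose_mat Q * A * Q = Matrix.mat 4 4 (\<lambda>(i,j).
          if (i,j) = (0,1) \<or> (i,j) = (1,0) then e1
          else if (i,j) = (2,2) then e2 else if (i,j) = (3,3) then e3 else 0) \<and>
       transpose_mat Q * B * Q = Matrix.mat 4 4 (\<lambda>(i,j).
          if (i,j) = (0,1) \<or> (i,j) = (1,0) then e1 * a
          else if (i,j) = (1,1) then e1
          else if (i,j) = (2,2) then e2 * b else if (i,j) = (3,3) then e3 * c else 0))"

text \<open>Symbols: Bar = a 1x1 block; Wr s = one copy of the wriggle symbol with sign
  subscript s (True = +, False = -).  An index sequence
  < s0 sigma1 s1 ... sigmar sr > is represented as (s0, [(sigma1,s1),...,(sigmar,sr)]).\<close>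

datatype isym = Bar | Wr bool

type_synonym iseq = "nat \<times> (isym list \<times> nat) list"

definition has_iseq :: "real mat \<Rightarrow> real mat \<Rightarrow> iseq \<Rightarrow> bool" where
  "has_iseq A B S \<longleftrightarrow>
    (\<exists>a b c e1 e2 e3. distinct [a,b,c] \<and> e1 \<in> {-1,1} \<and> e2 \<in> {-1,1} \<and> e3 \<in> {-1,1} \<and>
       canon211 A B a b c e1 e2 e3 \<and>
       (let r = sort [a,b,c];
            sg = (\<lambda>x. if x = a then [Wr (e1 = 1), Wr (e1 = 1)] else [Bar])
        in S = (Idx A B (r!0 - 1),
                [(sg (r!0), Idx A B ((r!0 + r!1)/2)),
                 (sg (r!1), Idx A B ((r!1 + r!2)/2)),
                 (sg (r!2), Idx A B (r!2 + 1))])))"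

definition iseq_equiv :: "real mat \<Rightarrow> real mat \<Rightarrow> iseq \<Rightarrow> bool" where
  "iseq_equiv A B S \<longleftrightarrow>
    (\<exists>\<alpha> \<beta> \<gamma> \<delta> :: real. \<alpha> * \<delta> - \<beta> * \<gamma> \<noteq> 0 \<and>
       Determinant.det (\<alpha> \<cdot>\<^sub>m A + \<beta> \<cdot>\<^sub>m B) \<noteq> 0 \<and>
       has_iseq (\<alpha> \<cdot>\<^sub>m A + \<beta> \<cdot>\<^sub>m B) (\<gamma> \<cdot>\<^sub>m A + \<delta> \<cdot>\<^sub>m B) S)"

text \<open>Points of PR^3 are represented by unit vectors of R^4 (PR^3 = S^3 / antipodal map).\<close>

definition qf :: "real mat \<Rightarrow> real^4 \<Rightarrow> real" where
  "qf A x = (\<Sum>i<4. \<Sum>j<4. A $$ (i,j) * x $ (of_nat i) * x $ (of_nat j))"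

definition qsic_sph :: "real mat \<Rightarrow> real mat \<Rightarrow> (real^4) set" where
  "qsic_sph A B = {x. norm x = 1 \<and> qf A x = 0 \<and> qf B x = 0}"

text \<open>Connected components of the real QSIC in PR^3, lifted to the sphere.\<close>

definition proj_components :: "real mat \<Rightarrow> real mat \<Rightarrow> (real^4) set set" where
  "proj_components A B = (\<lambda>K. K \<union> uminus ` K) ` components (qsic_sph A B)"

definition closed_comp :: "(real^4) set \<Rightarrow> bool" where
  "closed_comp C \<longleftrightarrow> (\<exists>h::real^4. h \<noteq> 0 \<and> (\<forall>x\<in>C. h \<bullet> x \<noteq> 0))"

text \<open>Singular (double) point: real point where the gradients AX, BX are dependent.\<close>

definition qsic_sing :: "real mat \<Rightarrow> real mat \<Rightarrow> real^4 \<Rightarrow> bool" where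
  "qsic_sing A B p \<longleftrightarrow> p \<in> qsic_sph A B \<and>
     (\<exists>\<mu> \<nu> :: real. (\<mu>, \<nu>) \<noteq> (0, 0) \<and>
        (\<forall>i<4. (\<Sum>j<4. (\<mu> * A $$ (i,j) + \<nu> * B $$ (i,j)) * p $ (of_nat j)) = 0))"

definition acnode :: "real mat \<Rightarrow> real mat \<Rightarrow> real^4 \<Rightarrow> bool" where
  "acnode A B p \<longleftrightarrow> qsic_sing A B p \<and> (\<exists>e::real>0. ball p e \<inter> qsic_sph A B = {p})"

definition crunode :: "real mat \<Rightarrow> real mat \<Rightarrow> real^4 \<Rightarrow> bool" where
  "crunode A B p \<longleftrightarrow> qsic_sing A B p \<and>
     (\<exists>e::real>0. \<exists>g1 g2 :: real \<Rightarrow> real^4.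
        continuous_on {-1..(1::real)} g1 \<and> inj_on g1 {-1..(1::real)} \<and>
        continuous_on {-1..(1::real)} g2 \<and> inj_on g2 {-1..(1::real)} \<and>
        g1 0 = p \<and> g2 0 = p \<and>
        g1 ` {-1..(1::real)} \<inter> g2 ` {-1..(1::real)} = {p} \<and>
        g1 ` {-1..(1::real)} \<union> g2 ` {-1..(1::real)} \<subseteq> qsic_sph A B \<and>
        ball p e \<inter> qsic_sph A B \<subseteq> g1 ` {-1..(1::real)} \<union> g2 ` {-1..(1::real)})"

definition S_22m :: iseq where "S_22m = (2, [([Wr False, Wr False], 2), ([Bar], 3), ([Bar], 2)])"
definition S_22p :: iseq where "S_22p = (2, [([Wr True, Wr True], 2), ([Bar], 3), ([Bar], 2)])"
definition S_11m :: iseq where "S_11m = (1, [([Wr False, Wr False], 1), ([Bar], 2), ([Bar], 3)])"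
definition S_11p :: iseq where "S_11p = (1, [([Wr True, Wr True], 1), ([Bar], 2), ([Bar], 3)])"

end

theory Submission
  imports Defs
begin

text \<open>In a Jordan basis of \<open>A\<inverse>B\<close> the symmetry of \<open>A\<close> and \<open>B\<close> forces the canonical form. Changing the basis
  of the pencil acts on the roots by a Moebius map and on the signs explicitly, so one may assume that
  the double root is the smallest one and that the sign of the next root is \<open>+\<close>; the two remaining
  signs give the four index sequences, the numbers \<open>Idx\<close> being read off from the canonical form by
  the law of inertia. Conversely, an index sequence determines the signs, and then the curve is, in
  canonical coordinates, \<open>2e\<^sub>1xy + e\<^sub>2z\<^sup>2 + e\<^sub>3w\<^sup>2 = 0 = e\<^sub>1y\<^sup>2 + e\<^sub>2(b - a)z\<^sup>2 + e\<^sub>3(c - a)w\<^sup>2\<close> with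
  \<open>a < b < c\<close>. The second equation is a cone over an ellipse (or over nothing), and the first one is
  solved for \<open>x\<close> away from the singular point \<open>(1, 0, 0, 0)\<close>.\<close>

no_notation Matrix.vec_index (infixl "$" 100)
no_notation Matrix.scalar_prod (infix "\<bullet>" 70)

section \<open>Congruence of symmetric matrices\<close>

text \<open>\<open>Idx\<close> counts eigenvalues, which a congruence does not preserve, whereas the
  canonical form is one of congruence; this is why the spectral theorem and Sylvester's law of
  inertia are needed. An index sequence belongs to some basis of the pencil, not to the given pair;
  the geometric claims transfer back because the curve depends only on the span of \<open>A\<close>
  and \<open>B\<close>. The member of the pencil at the double root has the double point in its
  kernel, which gives the second equation its simple form and the singularity at once. Projective
  points are pairs of antipodal unit vectors. A component is obtained from a connected compact set
  \<open>K\<close> on the sphere, and what has to be excluded is that \<open>K\<close> meets its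
  antipode. For the curve with a node this, the distinctness of the branches and the missing plane
  all rest on one constant being nonzero, which is where the two simple roots must differ.\<close>

lemma less_4_cases: "(i::nat) < 4 \<longleftrightarrow> i = 0 \<or> i = 1 \<or> i = 2 \<or> i = 3"
  by auto

lemma sum_lessThan_4: "(\<Sum>i<4. f i) = f 0 + f 1 + f 2 + f (3::nat)"
  by (simp add: eval_nat_numeral)

lemma index_mult_mat_4:
  assumes "A \<in> carrier_mat 4 4" "B \<in> carrier_mat 4 4" "i < 4" "j < 4"
  shows "(A * B) $$ (i,j) = A $$ (i,0) * B $$ (0,j) + A $$ (i,1) * B $$ (1,j)
     + A $$ (i,2) * B $$ (2,j) + A $$ (i,3) * B $$ (3,j)"
  using assms by (simp add: scalar_prod_def atLeast0LessThan sum_lessThan_4)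

lemma invertible_mat_iff_det:
  fixes Q :: "'a :: field mat"
  assumes "Q \<in> carrier_mat n n"
  shows "invertible_mat Q \<longleftrightarrow> Determinant.det Q \<noteq> 0"
proof
  assume "invertible_mat Q"
  then obtain B where B: "Q * B = 1\<^sub>m n" "B * Q = 1\<^sub>m (dim_row B)"
    using assms unfolding invertible_mat_def inverts_mat_def by auto
  \<comment> \<open>\<open>inverts_mat\<close> does not fix the size of the inverse; the column
    counts of the two products do.\<close>
  have "B \<in> carrier_mat n n"
    using arg_cong[OF B(1), of dim_col] arg_cong[OF B(2), of dim_col] assms by auto
  then have "Determinant.det Q * Determinant.det B = 1"
    using B(1) Determinant.det_mult[of Q n B] assms by simp
  then show "Determinant.det Q \<noteq> 0" by auto
next
  assume "Determinant.det Q \<noteq> 0"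
  from det_non_zero_imp_unit[OF assms this, unfolded Units_def ring_mat_def]
  obtain B where "B \<in> carrier_mat n n" "B * Q = 1\<^sub>m n" "Q * B = 1\<^sub>m n" by auto
  then show "invertible_mat Q"
    using assms unfolding invertible_mat_def inverts_mat_def by auto
qed

definition cong_mat :: "real mat \<Rightarrow> real mat \<Rightarrow> real mat" where
  "cong_mat Q A = transpose_mat Q * A * Q"

lemma cong_mat_carrier [simp]: "Q \<in> carrier_mat n n \<Longrightarrow> A \<in> carrier_mat n n \<Longrightarrow> cong_mat Q A \<in> carrier_mat n n"
  unfolding cong_mat_def by auto

lemma cong_mat_mult:
  assumes "Q \<in> carrier_mat n n" "R \<in> carrier_mat n n" "A \<in> carrier_mat n n"
  shows "cong_mat (Q * R) A = cong_mat R (cong_mat Q A)"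
proof -
  have "cong_mat (Q * R) A = transpose_mat R * transpose_mat Q * A * (Q * R)"
    using assms by (simp add: cong_mat_def transpose_mult[of Q n n R n])
  also have "\<dots> = transpose_mat R * (transpose_mat Q * A) * (Q * R)"
    using assms by (simp add: assoc_mult_mat[of _ n n _ n _ n])
  also have "\<dots> = transpose_mat R * (transpose_mat Q * A) * Q * R"
    using assms by (simp add: assoc_mult_mat[of _ n n _ n _ n])
  also have "\<dots> = transpose_mat R * (transpose_mat Q * A * Q) * R"
    using assms by (simp add: assoc_mult_mat[of _ n n _ n _ n])
  finally show ?thesis by (simp add: cong_mat_def)
qed

lemma cong_mat_lincomb:
  assumes "Q \<in> carrier_mat n n" "A \<in> carrier_mat n n" "B \<in> carrier_mat n n"
  shows "cong_mat Q (\<alpha> \<cdot>\<^sub>m A + \<beta> \<cdot>\<^sub>m B) = \<alpha> \<cdot>\<^sub>m cong_mat Q A + \<beta> \<cdot>\<^sub>m cong_mat Q B"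
  using assms unfolding cong_mat_def
  by (simp add: mult_add_distrib_mat[of _ n n _ n] add_mult_distrib_mat[of _ n n _ _ n]
      mult_smult_distrib[of _ n n _ n] mult_smult_assoc_mat[of _ n n _ n])

lemma det_cong_mat:
  assumes "Q \<in> carrier_mat n n" "A \<in> carrier_mat n n"
  shows "Determinant.det (cong_mat Q A) = (Determinant.det Q)\<^sup>2 * Determinant.det A"
  using assms unfolding cong_mat_def
  by (simp add: Determinant.det_mult[of _ n] Determinant.det_transpose power2_eq_square)

section \<open>The canonical form of Segre type [211]\<close>

text \<open>Both normal forms and all their linear combinations have this shape, so four parameters
  describe every member of the pencil. The zero at \<open>(0,0)\<close> says that the first basis
  vector lies on every quadric of the pencil.\<close>

definition blk :: "real \<Rightarrow> real \<Rightarrow> real \<Rightarrow> real \<Rightarrow> real mat" where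
  "blk p q r s = Matrix.mat 4 4 (\<lambda>(i,j).
     if (i,j) = (0,1) \<or> (i,j) = (1,0) then p
     else if (i,j) = (1,1) then q
     else if (i,j) = (2,2) then r else if (i,j) = (3,3) then s else 0)"

lemma blk_carrier [simp]: "blk p q r s \<in> carrier_mat 4 4"
  unfolding blk_def by simp

lemma blk_lincomb:
  "\<alpha> \<cdot>\<^sub>m blk p q r s + \<beta> \<cdot>\<^sub>m blk p' q' r' s'
    = blk (\<alpha> * p + \<beta> * p') (\<alpha> * q + \<beta> * q') (\<alpha> * r + \<beta> * r') (\<alpha> * s + \<beta> * s')"
  by (rule eq_matI) (auto simp: blk_def)

lemma canon211_iff:
  "canon211 A B a b c e1 e2 e3 \<longleftrightarrow>
    (\<exists>Q. Q \<in> carrier_mat 4 4 \<and> Determinant.det Q \<noteq> 0 \<and> cong_mat Q A = blk e1 0 e2 e3 \<and>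
       cong_mat Q B = blk (e1 * a) e1 (e2 * b) (e3 * c))"
proof -
  have 1: "Matrix.mat 4 4 (\<lambda>(i,j).
          if (i,j) = (0,1) \<or> (i,j) = (1,0) then e1
          else if (i,j) = (2,2) then e2 else if (i,j) = (3,3) then e3 else 0) = blk e1 0 e2 e3"
    by (rule eq_matI) (auto simp: blk_def)
  show ?thesis
    unfolding canon211_def 1 cong_mat_def[symmetric] blk_def[symmetric]
    using invertible_mat_iff_det by blast
qed

text \<open>Congruences by these matrices keep the shape \<open>blk\<close>: a shear and scaling in
  the first two coordinates, independent scalings in the other two.\<close>

definition tri :: "real \<Rightarrow> real \<Rightarrow> real \<Rightarrow> real \<Rightarrow> real \<Rightarrow> real mat" where
  "tri u v w m n = Matrix.mat 4 4 (\<lambda>(i,j).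
     if (i,j) = (0,0) then u else if (i,j) = (0,1) then v else if (i,j) = (1,1) then w
     else if (i,j) = (2,2) then m else if (i,j) = (3,3) then n else 0)"

lemma tri_carrier [simp]: "tri u v w m n \<in> carrier_mat 4 4"
  unfolding tri_def by simp

lemma det_tri: "Determinant.det (tri u v w m n) = u * w * m * n"
proof -
  have "upper_triangular (tri u v w m n)"
    by (auto simp: upper_triangular_def tri_def)
  then have "Determinant.det (tri u v w m n) = prod_list (diag_mat (tri u v w m n))"
    by (rule det_upper_triangular) (rule tri_carrier)
  also have "diag_mat (tri u v w m n) = [u, w, m, n]"
    by (simp add: diag_mat_def tri_def upt_rec)
  finally show ?thesis by simp
qed

lemma cong_tri_blk:
  "cong_mat (tri u v w m n) (blk p q r s) =
     blk (u * w * p) (2 * v * w * p + w\<^sup>2 * q) (m\<^sup>2 * r) (n\<^sup>2 * s)"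
  (is "?L = ?R")
proof (rule eq_matI)
  fix i j assume "i < dim_row ?R" "j < dim_col ?R"
  then have ij: "i < 4" "j < 4" by (auto simp: blk_def)
  have X: "(Matrix.transpose_mat (tri u v w m n) * blk p q r s) \<in> carrier_mat 4 4"
    by (rule mult_carrier_mat[of _ 4 4]) simp_all
  show "?L $$ (i,j) = ?R $$ (i,j)"
    unfolding cong_mat_def
    apply (subst index_mult_mat_4[OF X tri_carrier ij])
    apply (subst index_mult_mat_4, simp, simp, rule ij, simp)+
    using ij unfolding less_4_cases
    apply (elim disjE)
    apply (simp_all add: tri_def blk_def algebra_simps power2_eq_square)
    done
qed (auto simp: cong_mat_def blk_def tri_def)

text \<open>The shear \<open>v\<close> removes \<open>h\<close>; the remaining coefficients are rescaled to signs.\<close>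

lemma canon211I:
  assumes A: "A \<in> carrier_mat 4 4" and B: "B \<in> carrier_mat 4 4" and Q: "Q \<in> carrier_mat 4 4"
    and Qd: "Determinant.det Q \<noteq> 0"
    and QA: "cong_mat Q A = blk g h k l"
    and QB: "cong_mat Q B = blk (a * g) (a * h + d) (b * k) (c * l)"
    and nz: "g \<noteq> 0" "d \<noteq> 0" "k \<noteq> 0" "l \<noteq> 0"
  shows "canon211 A B a b c (sgn d) (sgn k) (sgn l)"
proof -
  \<comment> \<open>The values are forced by \<open>cong_tri_blk\<close>: \<open>w\<close> reduces
    \<open>d\<close> to its sign, \<open>u\<close> then has to satisfy
    \<open>u * w * g = sgn d\<close>, and \<open>v\<close> cancels \<open>w\<^sup>2 * h\<close>. As
    \<open>u\<close> may have either sign, the sign of the block is that of \<open>d\<close>, not of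
    \<open>g\<close>.\<close>
  define w where "w = 1 / sqrt \<bar>d\<bar>"
  define u where "u = sgn d / (w * g)"
  define v where "v = - w * h / (2 * g)"
  define m where "m = 1 / sqrt \<bar>k\<bar>"
  define n where "n = 1 / sqrt \<bar>l\<bar>"
  have *: "(1 / sqrt \<bar>x\<bar>)\<^sup>2 * x = sgn x" if "x \<noteq> 0" for x :: real
    using that by (simp add: power_divide sgn_if)
  have wd: "w\<^sup>2 * d = sgn d" and mk: "m\<^sup>2 * k = sgn k" and nl: "n\<^sup>2 * l = sgn l"
    unfolding w_def m_def n_def using * nz by auto
  have w0: "w \<noteq> 0" "m \<noteq> 0" "n \<noteq> 0" using nz by (auto simp: w_def m_def n_def)
  have ug: "u * w * g = sgn d" using w0 nz by (simp add: u_def)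
  have v0: "2 * v * w * g + w\<^sup>2 * h = 0" using nz by (simp add: v_def field_simps power2_eq_square)
  let ?R = "tri u v w m n"
  have QR: "Q * ?R \<in> carrier_mat 4 4" using Q by (rule mult_carrier_mat) simp
  have d: "Determinant.det (Q * ?R) \<noteq> 0"
    using w0 nz Qd Q by (auto simp: Determinant.det_mult[of _ 4] det_tri u_def sgn_if)
  have 1: "cong_mat (Q * ?R) A = blk (sgn d) 0 (sgn k) (sgn l)"
    using A Q by (simp add: cong_mat_mult QA cong_tri_blk ug v0 mk nl)
  have e1: "u * w * (a * g) = sgn d * a" using ug by (simp add: algebra_simps)
  have e2: "2 * v * w * (a * g) + w\<^sup>2 * (a * h + d) = sgn d"
  proof -
    have "2 * v * w * (a * g) + w\<^sup>2 * (a * h + d) = a * (2 * v * w * g + w\<^sup>2 * h) + w\<^sup>2 * d"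
      by (simp add: algebra_simps)
    then show ?thesis by (simp add: v0 wd)
  qed
  have e3: "m\<^sup>2 * (b * k) = sgn k * b" "n\<^sup>2 * (c * l) = sgn l * c"
    using mk nl by (auto simp: algebra_simps)
  have 2: "cong_mat (Q * ?R) B = blk (sgn d * a) (sgn d) (sgn k * b) (sgn l * c)"
    using B Q by (simp add: cong_mat_mult QB cong_tri_blk e1 e2 e3)
  show ?thesis unfolding canon211_iff using QR d 1 2 by blast
qed

definition swp :: "real mat" where
  "swp = Matrix.mat 4 4 (\<lambda>(i,j).
     if (i,j) \<in> {(0,0),(1,1),(2,3),(3,2)} then 1 else 0)"

lemma swp_carrier [simp]: "swp \<in> carrier_mat 4 4"
  unfolding swp_def by simp

lemma det_swp: "Determinant.det swp \<noteq> 0"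
proof -
  have "swp * swp = 1\<^sub>m 4"
  proof (rule eq_matI)
    fix i j assume "i < dim_row (1\<^sub>m 4 :: real mat)" "j < dim_col (1\<^sub>m 4 :: real mat)"
    then have ij: "i < 4" "j < 4" by auto
    show "(swp * swp) $$ (i,j) = 1\<^sub>m 4 $$ (i,j)"
      apply (subst index_mult_mat_4[OF swp_carrier swp_carrier ij])
      using ij unfolding less_4_cases
      by (elim disjE) (simp_all add: swp_def)
  qed (auto simp: swp_def)
  then have "Determinant.det swp * Determinant.det swp = 1"
    by (metis Determinant.det_mult Determinant.det_one swp_carrier)
  then show ?thesis by auto
qed

lemma cong_swp_blk: "cong_mat swp (blk p q r s) = blk p q s r"
  (is "?L = ?R")
proof (rule eq_matI)
  fix i j assume "i < dim_row ?R" "j < dim_col ?R"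
  then have ij: "i < 4" "j < 4" by (auto simp: blk_def)
  have X: "(Matrix.transpose_mat swp * blk p q r s) \<in> carrier_mat 4 4"
    by (rule mult_carrier_mat[of _ 4 4]) simp_all
  show "?L $$ (i,j) = ?R $$ (i,j)"
    unfolding cong_mat_def
    apply (subst index_mult_mat_4[OF X swp_carrier ij])
    apply (subst index_mult_mat_4, simp, simp, rule ij, simp)+
    using ij unfolding less_4_cases
    apply (elim disjE)
    apply (simp_all add: swp_def blk_def)
    done
qed (auto simp: cong_mat_def blk_def swp_def)

text \<open>\<open>canon211\<close> imposes no order on the simple roots. Exchanging them permits
  the assumption \<open>b < c\<close>, or a choice of which root goes with the third
  coordinate.\<close>

lemma canon211_swap:
  assumes "A \<in> carrier_mat 4 4" "B \<in> carrier_mat 4 4" "canon211 A B a b c e1 e2 e3"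
  shows "canon211 A B a c b e1 e3 e2"
proof -
  obtain Q where Q: "Q \<in> carrier_mat 4 4" "Determinant.det Q \<noteq> 0" "cong_mat Q A = blk e1 0 e2 e3"
       "cong_mat Q B = blk (e1 * a) e1 (e2 * b) (e3 * c)"
    using assms(3) unfolding canon211_iff by blast
  have "Q * swp \<in> carrier_mat 4 4" using Q by (intro mult_carrier_mat) auto
  moreover have "Determinant.det (Q * swp) \<noteq> 0"
    using Q det_swp by (simp add: Determinant.det_mult[of _ 4])
  moreover have "cong_mat (Q * swp) A = blk e1 0 e3 e2"
      "cong_mat (Q * swp) B = blk (e1 * a) e1 (e3 * c) (e2 * b)"
    using Q assms by (simp_all add: cong_mat_mult cong_swp_blk)
  ultimately show ?thesis unfolding canon211_iff by blast
qed

text \<open>The roots move by the Moebius map \<open>\<lambda> \<mapsto> (\<gamma> + \<delta>\<lambda>) / (\<alpha> + \<beta>\<lambda>)\<close>; the sign of the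
  \<open>2 \<times> 2\<close> block is governed by its derivative at \<open>a\<close>, whence the determinant.\<close>

lemma canon211_basis_change:
  assumes A: "A \<in> carrier_mat 4 4" and B: "B \<in> carrier_mat 4 4"
    and can: "canon211 A B a b c e1 e2 e3" and e: "e1 \<noteq> 0" "e2 \<noteq> 0" "e3 \<noteq> 0"
    and nz: "\<alpha> + \<beta> * a \<noteq> 0" "\<alpha> + \<beta> * b \<noteq> 0" "\<alpha> + \<beta> * c \<noteq> 0" "\<alpha> * \<delta> - \<beta> * \<gamma> \<noteq> 0"
  shows "canon211 (\<alpha> \<cdot>\<^sub>m A + \<beta> \<cdot>\<^sub>m B) (\<gamma> \<cdot>\<^sub>m A + \<delta> \<cdot>\<^sub>m B)
     ((\<gamma> + \<delta> * a) / (\<alpha> + \<beta> * a)) ((\<gamma> + \<delta> * b) / (\<alpha> + \<beta> * b)) ((\<gamma> + \<delta> * c) / (\<alpha> + \<beta> * c))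
     (sgn (e1 * (\<alpha> * \<delta> - \<beta> * \<gamma>) / (\<alpha> + \<beta> * a))) (sgn (e2 * (\<alpha> + \<beta> * b))) (sgn (e3 * (\<alpha> + \<beta> * c)))"
proof -
  obtain Q where Q: "Q \<in> carrier_mat 4 4" "Determinant.det Q \<noteq> 0" "cong_mat Q A = blk e1 0 e2 e3"
       "cong_mat Q B = blk (e1 * a) e1 (e2 * b) (e3 * c)"
    using can unfolding canon211_iff by blast
  show ?thesis
  proof (rule canon211I)
    show "cong_mat Q (\<alpha> \<cdot>\<^sub>m A + \<beta> \<cdot>\<^sub>m B)
        = blk (e1 * (\<alpha> + \<beta> * a)) (\<beta> * e1) (e2 * (\<alpha> + \<beta> * b)) (e3 * (\<alpha> + \<beta> * c))"
      using Q A B by (simp add: cong_mat_lincomb blk_lincomb algebra_simps)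
    \<comment> \<open>This splits the \<open>(1,1)\<close> entry \<open>\<delta> * e1\<close> of the
      new second form as \<open>canon211I\<close> requires: the new double root times the
      \<open>(1,1)\<close> entry of the new first form, plus a remainder \<open>d\<close> that
      carries the determinant.\<close>
    have E: "(\<gamma> + \<delta> * a) / (\<alpha> + \<beta> * a) * (\<beta> * e1) + e1 * (\<alpha> * \<delta> - \<beta> * \<gamma>) / (\<alpha> + \<beta> * a) = \<delta> * e1"
    proof -
      have "(\<gamma> + \<delta> * a) * (\<beta> * e1) + e1 * (\<alpha> * \<delta> - \<beta> * \<gamma>) = \<delta> * e1 * (\<alpha> + \<beta> * a)"
        by (simp add: algebra_simps)
      then show ?thesis using nz
        by (metis add_divide_distrib nonzero_mult_div_cancel_right times_divide_eq_left)
    qed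
    show "cong_mat Q (\<gamma> \<cdot>\<^sub>m A + \<delta> \<cdot>\<^sub>m B) = blk ((\<gamma> + \<delta> * a) / (\<alpha> + \<beta> * a) * (e1 * (\<alpha> + \<beta> * a)))
       ((\<gamma> + \<delta> * a) / (\<alpha> + \<beta> * a) * (\<beta> * e1) + e1 * (\<alpha> * \<delta> - \<beta> * \<gamma>) / (\<alpha> + \<beta> * a))
       ((\<gamma> + \<delta> * b) / (\<alpha> + \<beta> * b) * (e2 * (\<alpha> + \<beta> * b))) ((\<gamma> + \<delta> * c) / (\<alpha> + \<beta> * c) * (e3 * (\<alpha> + \<beta> * c)))"
      unfolding E using Q A B nz by (simp add: cong_mat_lincomb blk_lincomb) (simp add: algebra_simps)
  qed (use A B Q e nz in auto)
qed

text \<open>The canonical Gram matrix has an explicit inverse of the same shape. This supplies the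
  nonsingularity that \<open>iseq_equiv\<close> demands of the first matrix.\<close>

lemma canon211_imp_det:
  assumes A: "A \<in> carrier_mat 4 4"
    and can: "canon211 A B a b c e1 e2 e3" and e: "e1 \<noteq> 0" "e2 \<noteq> 0" "e3 \<noteq> 0"
  shows "Determinant.det A \<noteq> 0"
proof -
  obtain Q where Q: "Q \<in> carrier_mat 4 4" "Determinant.det Q \<noteq> 0" "cong_mat Q A = blk e1 0 e2 e3"
    using can unfolding canon211_iff by blast
  have "blk e1 0 e2 e3 * blk (1/e1) 0 (1/e2) (1/e3) = 1\<^sub>m 4" (is "?L * ?M = _")
  proof (rule eq_matI)
    fix i j assume "i < dim_row (1\<^sub>m 4 :: real mat)" "j < dim_col (1\<^sub>m 4 :: real mat)"
    then have ij: "i < 4" "j < 4" by auto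
    show "(?L * ?M) $$ (i,j) = 1\<^sub>m 4 $$ (i,j)"
      apply (subst index_mult_mat_4[OF blk_carrier blk_carrier ij])
      using ij e unfolding less_4_cases
      by (elim disjE) (simp_all add: blk_def)
  qed (auto simp: blk_def)
  then have "Determinant.det ?L * Determinant.det ?M = 1"
    by (metis Determinant.det_mult Determinant.det_one blk_carrier)
  then have "Determinant.det (cong_mat Q A) \<noteq> 0" using Q by auto
  then show ?thesis using det_cong_mat[OF Q(1) A] by auto
qed

section \<open>From the Jordan form to the canonical form\<close>

lemma jordan_matrix_211:
  "jordan_matrix [(2, a), (1, b), (1, c :: real)] = Matrix.mat 4 4 (\<lambda>(i,j).
     if (i,j) = (0,0) \<or> (i,j) = (1,1) then a else if (i,j) = (0,1) then 1
     else if (i,j) = (2,2) then b else if (i,j) = (3,3) then c else 0)"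
  by (rule eq_matI) (auto simp: jordan_matrix_def Let_def four_block_mat_def jordan_block_def less_4_cases)

text \<open>In a Jordan basis \<open>P\<close> the Gram matrices of \<open>A\<close> and \<open>B\<close> are \<open>G\<close> and \<open>G * J\<close>; symmetry of both
  forces the block shape of \<open>G\<close>.\<close>

lemma canon211_exists:
  assumes A: "A \<in> carrier_mat 4 4" and B: "B \<in> carrier_mat 4 4"
    and At: "transpose_mat A = A" and Bt: "transpose_mat B = B"
    and abc: "distinct [a, b, c]"
    and Ai: "Ai \<in> carrier_mat 4 4" "Ai * A = 1\<^sub>m 4"
    and jnf: "jordan_nf (Ai * B) [(2, a), (1, b), (1, c)]"
  shows "\<exists>e1 e2 e3. e1 \<in> {-1,1} \<and> e2 \<in> {-1,1} \<and> e3 \<in> {-1,1} \<and> canon211 A B a b c e1 e2 e3"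
proof -
  define J where "J = jordan_matrix [(2, a), (1, b), (1, c)]"
  have AiB: "Ai * B \<in> carrier_mat 4 4" using Ai B by simp
  obtain P R where "similar_mat_wit (Ai * B) J P R"
    using jnf unfolding jordan_nf_def similar_mat_def J_def by blast
  from similar_mat_witD2[OF AiB this]
  have PR: "P * R = 1\<^sub>m 4" "R * P = 1\<^sub>m 4" and eq: "Ai * B = P * J * R"
    and P: "P \<in> carrier_mat 4 4" and R: "R \<in> carrier_mat 4 4" and J: "J \<in> carrier_mat 4 4" by auto
  have AAi: "A * Ai = 1\<^sub>m 4" using mat_mult_left_right_inverse[OF Ai(1) A Ai(2)] .
  have "B = A * (Ai * B)"
    using AAi A Ai B by (simp flip: assoc_mult_mat[of A 4 4 Ai 4 B 4])
  then have "B * P = A * (P * J * R) * P" by (simp add: eq)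
  also have "\<dots> = A * (P * J * (R * P))"
    using A P J R by (simp add: assoc_mult_mat[of _ 4 4 _ 4 _ 4])
  also have "\<dots> = A * (P * J)" using PR P J by simp
  finally have BP: "B * P = A * P * J" using A P J by (simp add: assoc_mult_mat[of _ 4 4 _ 4 _ 4])
  define G where "G = cong_mat P A"
  define H where "H = cong_mat P B"
  have G: "G \<in> carrier_mat 4 4" and H: "H \<in> carrier_mat 4 4" using A B P by (auto simp: G_def H_def)
  have HGJ: "H = G * J"
    unfolding H_def G_def cong_mat_def using A B P J BP
    by (simp add: assoc_mult_mat[of _ 4 4 _ 4 _ 4])
  have symm: "transpose_mat (cong_mat P M) = cong_mat P M"
    if "M \<in> carrier_mat 4 4" "transpose_mat M = M" for M
    using that P unfolding cong_mat_def
    by (simp add: transpose_mult[of _ 4 4 _ 4] assoc_mult_mat[of _ 4 4 _ 4 _ 4])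
  have Gs: "G $$ (i,j) = G $$ (j,i)" if "i < 4" "j < 4" for i j
    using symm[OF A At] G that by (metis G_def carrier_matD index_transpose_mat(1))
  have Hs: "H $$ (i,j) = H $$ (j,i)" if "i < 4" "j < 4" for i j
    using symm[OF B Bt] H that by (metis H_def carrier_matD index_transpose_mat(1))
  have Hx: "H $$ (i,0) = a * G $$ (i,0)" "H $$ (i,1) = a * G $$ (i,1) + G $$ (i,0)"
      "H $$ (i,2) = b * G $$ (i,2)" "H $$ (i,3) = c * G $$ (i,3)" if "i < 4" for i
  proof -
    note * = index_mult_mat_4[OF G J that] J_def[unfolded jordan_matrix_211]
    show "H $$ (i,0) = a * G $$ (i,0)" "H $$ (i,1) = a * G $$ (i,1) + G $$ (i,0)"
      "H $$ (i,2) = b * G $$ (i,2)" "H $$ (i,3) = c * G $$ (i,3)"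
      unfolding HGJ by (subst *(1), simp, simp add: *(2))+
  qed
  \<comment> \<open>Symmetry of \<open>G * J\<close> does the work: the superdiagonal 1 kills the
    \<open>(0,0)\<close> entry, and vectors for different eigenvalues are orthogonal since
    \<open>a\<close>, \<open>b\<close>, \<open>c\<close> are distinct. For the generalized
    eigenvector with index 1 an extra term appears, which \<open>z02\<close> and \<open>z03\<close>
    remove.\<close>
  have z00: "G $$ (0,0) = 0" using Hs[of 0 1] Hx(2)[of 0] Hx(1)[of 1] Gs[of 0 1] by simp
  have z02: "G $$ (0,2) = 0" using Hs[of 0 2] Hx(3)[of 0] Hx(1)[of 2] Gs[of 0 2] abc by simp
  have z03: "G $$ (0,3) = 0" using Hs[of 0 3] Hx(4)[of 0] Hx(1)[of 3] Gs[of 0 3] abc by simp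
  have z12: "G $$ (1,2) = 0"
    using Hs[of 1 2] Hx(3)[of 1] Hx(2)[of 2] Gs[of 1 2] Gs[of 0 2] z02 abc by simp
  have z13: "G $$ (1,3) = 0"
    using Hs[of 1 3] Hx(4)[of 1] Hx(2)[of 3] Gs[of 1 3] Gs[of 0 3] z03 abc by simp
  have z23: "G $$ (2,3) = 0"
    using Hs[of 2 3] Hx(4)[of 2] Hx(3)[of 3] Gs[of 2 3] abc by simp
  define g h k l where "g = G $$ (0,1)" and "h = G $$ (1,1)" and "k = G $$ (2,2)" and "l = G $$ (3,3)"
  have Gb: "G = blk g h k l"
  proof (rule eq_matI)
    fix i j assume "i < dim_row (blk g h k l)" "j < dim_col (blk g h k l)"
    then have ij: "i < 4" "j < 4" by (auto simp: blk_def)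
    show "G $$ (i,j) = blk g h k l $$ (i,j)"
      using ij unfolding less_4_cases
      apply (elim disjE)
      using z00 z02 z03 z12 z13 z23 Gs[of 1 0] Gs[of 2 0] Gs[of 3 0] Gs[of 2 1] Gs[of 3 1] Gs[of 3 2]
      by (simp_all add: blk_def g_def h_def k_def l_def)
  qed (use G in \<open>auto simp: blk_def\<close>)
  have Hb: "H = blk (a * g) (a * h + g) (b * k) (c * l)"
  proof (rule eq_matI)
    fix i j assume "i < dim_row (blk (a * g) (a * h + g) (b * k) (c * l))" "j < dim_col (blk (a * g) (a * h + g) (b * k) (c * l))"
    then have ij: "i < 4" "j < 4" by (auto simp: blk_def)
    show "H $$ (i,j) = blk (a * g) (a * h + g) (b * k) (c * l) $$ (i,j)"
      using ij(2) unfolding less_4_cases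
      apply (elim disjE)
      using ij(1)
         apply (simp_all add: Hx Hx[unfolded One_nat_def])
      unfolding less_4_cases Gb
      by (auto simp: blk_def)
  qed (use H in \<open>auto simp: blk_def\<close>)
  have dA: "Determinant.det A \<noteq> 0"
  proof -
    have "Determinant.det Ai * Determinant.det A = 1"
      using Ai A by (metis Determinant.det_mult Determinant.det_one)
    then show ?thesis by auto
  qed
  have dP: "Determinant.det P \<noteq> 0"
  proof -
    have "Determinant.det P * Determinant.det R = 1"
      using PR P R by (metis Determinant.det_mult Determinant.det_one)
    then show ?thesis by auto
  qed
  have dG: "Determinant.det G \<noteq> 0" using det_cong_mat[OF P A] dA dP by (simp add: G_def)
  have "g \<noteq> 0 \<and> k \<noteq> 0 \<and> l \<noteq> 0"
  proof (rule ccontr)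
    assume *: "\<not> (g \<noteq> 0 \<and> k \<noteq> 0 \<and> l \<noteq> 0)"
    \<comment> \<open>If one of the three parameters vanishes, so does a whole column of
      \<open>G\<close>; \<open>i\<close> is the index of that column, and its unit vector lies in
      the kernel.\<close>
    define i where "i = (if g = 0 then 0 else if k = 0 then 2 else (3::nat))"
    define v :: "real Matrix.vec" where "v = unit_vec 4 i"
    have "G *\<^sub>v v = 0\<^sub>v 4"
      using * by (intro eq_vecI)
        (auto simp: v_def i_def Gb blk_def scalar_prod_def row_def less_4_cases
            unit_vec_def sum.delta atLeast0LessThan sum_lessThan_4)
    moreover have "v \<in> carrier_vec 4" "v \<noteq> 0\<^sub>v 4"
      by (auto simp: v_def i_def)
    ultimately show False using det_0_iff_vec_prod_zero[OF G] dG by blast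
  qed
  \<comment> \<open>Here \<open>d = g\<close>, because the superdiagonal 1 of \<open>J\<close>
    copies \<open>g\<close> into the \<open>(1,1)\<close> entry of \<open>H\<close>.\<close>
  then have "canon211 A B a b c (sgn g) (sgn k) (sgn l)"
    using canon211I[OF A B P dP, of g h k l a g b c] Gb Hb by (simp add: G_def H_def)
  moreover have "sgn x \<in> {-1,1}" if "x \<noteq> 0" for x :: real using that by (auto simp: sgn_if)
  ultimately show ?thesis using \<open>g \<noteq> 0 \<and> k \<noteq> 0 \<and> l \<noteq> 0\<close> by blast
qed

section \<open>Spectral theorem and inertia\<close>

text \<open>The library indexes \<open>real^4\<close> by \<open>1, 2, 3, 4\<close> with \<open>4 = 0\<close>; \<open>idx4\<close> inverts \<open>of_nat\<close> on \<open>{..<4}\<close>.\<close>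

definition idx4 :: "4 \<Rightarrow> nat" where
  "idx4 i = (if i = 1 then 1 else if i = 2 then 2 else if i = 3 then 3 else 0)"

lemma four_eq_zero: "(4::4) = 0"
  by simp

lemma exhaust_4': "(i::4) = 0 \<or> i = 1 \<or> i = 2 \<or> i = 3"
  using exhaust_4[of i] unfolding four_eq_zero by blast

lemma UNIV_4': "(UNIV :: 4 set) = {0, 1, 2, 3}"
  unfolding UNIV_4 four_eq_zero by blast

lemma sum_UNIV_4: "sum f (UNIV :: 4 set) = f 0 + f 1 + f 2 + f 3"
  unfolding UNIV_4' by (simp add: add.assoc)

lemma idx4_less [simp]: "idx4 i < 4"
  by (simp add: idx4_def)

lemma of_nat_idx4 [simp]: "of_nat (idx4 i) = i"
  using exhaust_4'[of i] by (auto simp: idx4_def)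

lemma idx4_of_nat [simp]: "i < 4 \<Longrightarrow> idx4 (of_nat i) = i"
  unfolding less_4_cases by (elim disjE) (simp_all add: idx4_def)

lemma inj_idx4: "inj idx4"
  by (rule inj_on_inverseI[of _ of_nat]) (rule of_nat_idx4)

lemma sum_lessThan_4_UNIV: "(\<Sum>i<4. f i) = (\<Sum>i\<in>UNIV. f (idx4 i))"
  by (simp add: sum_lessThan_4 sum_UNIV_4 idx4_def)

text \<open>The bridge between the two libraries: the pencil consists of matrices of type
  \<open>mat\<close>, while dimension, inner product and topology live on
  \<open>real^4\<close>.\<close>

definition lin :: "real mat \<Rightarrow> real^4 \<Rightarrow> real^4" where
  "lin M x = (\<chi> i. \<Sum>j\<in>UNIV. M $$ (idx4 i, idx4 j) * x $ j)"

lemma linear_lin: "linear (lin M)"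
  by (rule linearI)
    (simp_all add: lin_def vec_eq_iff sum.distrib distrib_left sum_distrib_left mult.left_commute)

lemma lin_mult:
  assumes "A \<in> carrier_mat 4 4" "B \<in> carrier_mat 4 4"
  shows "lin (A * B) x = lin A (lin B x)"
proof -
  have E: "(A * B) $$ (idx4 i, idx4 j) = (\<Sum>k\<in>UNIV. A $$ (idx4 i, idx4 k) * B $$ (idx4 k, idx4 j))" for i j
    using assms by (simp add: scalar_prod_def atLeast0LessThan sum_lessThan_4_UNIV)
  have "lin (A * B) x $ i = lin A (lin B x) $ i" for i
  proof -
    have "lin (A * B) x $ i = (\<Sum>j\<in>UNIV. \<Sum>k\<in>UNIV. A $$ (idx4 i, idx4 k) * B $$ (idx4 k, idx4 j) * x $ j)"
      by (simp add: lin_def E sum_distrib_right del: index_mult_mat)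
    also have "\<dots> = (\<Sum>k\<in>UNIV. \<Sum>j\<in>UNIV. A $$ (idx4 i, idx4 k) * B $$ (idx4 k, idx4 j) * x $ j)"
      by (rule sum.swap)
    also have "\<dots> = lin A (lin B x) $ i"
      by (simp add: lin_def sum_distrib_left mult.assoc)
    finally show ?thesis .
  qed
  then show ?thesis by (simp add: vec_eq_iff)
qed

lemma lin_one [simp]: "lin (1\<^sub>m 4) x = x"
  by (simp add: lin_def vec_eq_iff inj_eq[OF inj_idx4] mult_delta_left)

lemma inner_lin:
  assumes "A \<in> carrier_mat 4 4"
  shows "lin (transpose_mat A) x \<bullet> y = x \<bullet> lin A y"
proof -
  have "lin (transpose_mat A) x \<bullet> y = (\<Sum>i\<in>UNIV. \<Sum>j\<in>UNIV. x $ j * A $$ (idx4 j, idx4 i) * y $ i)"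
    using assms by (simp add: lin_def inner_vec_def sum_distrib_right) (simp add: mult_ac)
  also have "\<dots> = (\<Sum>j\<in>UNIV. \<Sum>i\<in>UNIV. x $ j * A $$ (idx4 j, idx4 i) * y $ i)"
    by (rule sum.swap)
  also have "\<dots> = x \<bullet> lin A y"
    by (simp add: lin_def inner_vec_def sum_distrib_left) (simp add: mult_ac)
  finally show ?thesis .
qed

lemma qf_eq: "qf A x = x \<bullet> lin A x"
  by (simp add: qf_def lin_def inner_vec_def sum_lessThan_4_UNIV sum_distrib_left) (simp add: mult_ac)

lemma qf_cong_mat:
  assumes "Q \<in> carrier_mat 4 4" "A \<in> carrier_mat 4 4"
  shows "qf (cong_mat Q A) x = qf A (lin Q x)"
proof -
  have "transpose_mat Q * A \<in> carrier_mat 4 4" using assms by (intro mult_carrier_mat[of _ 4 4]) auto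
  then show ?thesis
    using assms by (simp add: qf_eq cong_mat_def lin_mult flip: inner_lin)
qed

lemma inj_lin:
  assumes Q: "Q \<in> carrier_mat 4 4" "Determinant.det Q \<noteq> 0"
  shows "inj (lin Q)"
proof -
  from det_non_zero_imp_unit[OF assms, unfolded Units_def ring_mat_def]
  obtain B where "B \<in> carrier_mat 4 4" "B * Q = 1\<^sub>m 4" by auto
  then have "lin B (lin Q x) = x" for x using lin_mult[of B Q x] Q by simp
  then show ?thesis by (metis injI)
qed

lemma lin_axis: "lin M (axis j 1) $ i = M $$ (idx4 i, idx4 j)"
  by (simp add: lin_def axis_def mult_delta_right)

text \<open>A maximizer of the Rayleigh quotient on \<open>S\<close> is an eigenvector; induct on its orthogonal complement.\<close>

lemma self_adjoint_eigenbasis: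
  fixes f :: "'a::euclidean_space \<Rightarrow> 'a"
  assumes lf: "linear f" and sa: "\<And>x y. f x \<bullet> y = x \<bullet> f y"
    and S: "subspace S" "f ` S \<subseteq> S"
  shows "\<exists>B\<subseteq>S. pairwise orthogonal B \<and> (\<forall>b\<in>B. norm b = 1 \<and> (\<exists>d. f b = d *\<^sub>R b)) \<and> span B = S"
  using S
proof (induction "dim S" arbitrary: S rule: less_induct)
  case less
  show ?case
  proof (cases "S = {0}")
    case True
    then show ?thesis by (intro exI[of _ "{}"]) auto
  next
    case False
    then obtain x0 where x0: "x0 \<in> S" "x0 \<noteq> 0" using subspace_0[OF less.prems(1)] by blast
    let ?K = "sphere 0 1 \<inter> S"
    have "compact ?K" by (intro compact_Int_closed closed_subspace less.prems) auto
    moreover have "x0 /\<^sub>R norm x0 \<in> ?K"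
      using x0 less.prems by (auto intro: subspace_mul)
    moreover have "continuous_on ?K (\<lambda>x. x \<bullet> f x)"
      using lf by (intro continuous_intros linear_continuous_on) (simp add: linear_conv_bounded_linear)
    ultimately obtain v where v: "v \<in> ?K" and max: "\<And>x. x \<in> ?K \<Longrightarrow> x \<bullet> f x \<le> v \<bullet> f v"
      using continuous_attains_sup[of ?K "\<lambda>x. x \<bullet> f x"] by blast
    define m where "m = v \<bullet> f v"
    have vv: "v \<bullet> v = 1" "norm v = 1" and vS: "v \<in> S" using v by (auto simp: norm_eq_1)
    have le: "x \<bullet> f x \<le> m * (x \<bullet> x)" if "x \<in> S" for x
    proof (cases "x = 0")
      case True
      then show ?thesis by simp
    next
      case False
      have "(x /\<^sub>R norm x) \<bullet> f (x /\<^sub>R norm x) \<le> m"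
        unfolding m_def using that False less.prems by (intro max) (auto intro: subspace_mul)
      then have "(x \<bullet> f x) / (norm x)\<^sup>2 \<le> m"
        using lf by (simp add: linear_cmul power2_eq_square field_simps)
      then show ?thesis using False by (simp add: field_simps power2_norm_eq_inner)
    qed
    define w where "w = f v - m *\<^sub>R v"
    have wS: "w \<in> S" unfolding w_def using vS less.prems
      by (intro subspace_diff subspace_mul) auto
    have wv: "w \<bullet> v = 0" unfolding w_def m_def using vv
      by (simp add: inner_diff_left inner_diff_right inner_commute)
    have wf: "w \<bullet> f v = w \<bullet> w"
      using wv by (simp add: w_def inner_diff_right inner_diff_left inner_commute)
    \<comment> \<open>Maximality tested at \<open>v + t *\<^sub>R w\<close>, where \<open>w\<close>
      is the residual of the eigenvalue equation. The left side is of first order in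
      \<open>t\<close>, the right side of second order, so a small positive \<open>t\<close> forces
      \<open>w = 0\<close>.\<close>
    have ineq: "2 * t * (w \<bullet> w) \<le> t\<^sup>2 * (m * (w \<bullet> w) - w \<bullet> f w)" for t
    proof -
      have I: "(v + t *\<^sub>R w) \<bullet> f (v + t *\<^sub>R w) \<le> m * ((v + t *\<^sub>R w) \<bullet> (v + t *\<^sub>R w))"
        using vS wS less.prems by (intro le subspace_add subspace_mul) auto
      have E1: "(v + t *\<^sub>R w) \<bullet> f (v + t *\<^sub>R w) = m + 2 * t * (w \<bullet> w) + t\<^sup>2 * (w \<bullet> f w)"
        using lf wf sa[of v w]
        by (simp add: linear_add linear_cmul inner_add_left inner_add_right m_def power2_eq_square inner_commute[of "f v" w])
      have E2: "(v + t *\<^sub>R w) \<bullet> (v + t *\<^sub>R w) = 1 + t\<^sup>2 * (w \<bullet> w)"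
        using wv vv by (simp add: inner_add_left inner_add_right power2_eq_square inner_commute[of v w])
      show ?thesis using I unfolding E1 E2 by (simp add: algebra_simps)
    qed
    have "w \<bullet> w = 0"
    proof (rule ccontr)
      assume "w \<bullet> w \<noteq> 0"
      then have pos: "w \<bullet> w > 0" by simp
      \<comment> \<open>A bound for the second order coefficient; the summand 1 makes it positive.
        With \<open>t = (w \<bullet> w) / C\<close> the inequality becomes
        \<open>2 * (w \<bullet> w) \<le> w \<bullet> w\<close>.\<close>
      define C where "C = \<bar>m * (w \<bullet> w) - w \<bullet> f w\<bar> + 1"
      have C: "C > 0" by (simp add: C_def)
      define t where "t = (w \<bullet> w) / C"
      have t: "t > 0" using pos C by (simp add: t_def)
      have "2 * t * (w \<bullet> w) \<le> t\<^sup>2 * C"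
        using ineq[of t] by (rule order_trans) (auto intro!: mult_left_mono simp: C_def)
      then have "2 * (w \<bullet> w) \<le> t * C" using t by (simp add: power2_eq_square)
      then show False using pos C by (simp add: t_def)
    qed
    then have fv: "f v = m *\<^sub>R v" by (simp add: w_def)
    define S' where "S' = {x \<in> S. x \<bullet> v = 0}"
    have S': "subspace S'" unfolding S'_def using less.prems(1)
      by (auto simp: subspace_def inner_add_left)
    \<comment> \<open>Self-adjointness moves \<open>f\<close> onto \<open>v\<close>, which is an
      eigenvector, so orthogonality to \<open>v\<close> is preserved.\<close>
    have fS': "f ` S' \<subseteq> S'"
      unfolding S'_def using less.prems(2) by (auto simp: sa fv)
    have "v \<notin> S'" using vv by (simp add: S'_def)
    moreover have "S' \<subseteq> S" by (auto simp: S'_def)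
    ultimately have "S' \<subset> S" using vS by blast
    then have "dim S' < dim S"
      using S' less.prems(1) by (metis dim_psubset span_eq_iff)
    from less.hyps[OF this S' fS'] obtain B where
      B: "B \<subseteq> S'" "pairwise orthogonal B" "\<And>b. b \<in> B \<Longrightarrow> norm b = 1 \<and> (\<exists>d. f b = d *\<^sub>R b)" "span B = S'"
      by blast
    show ?thesis
    proof (intro exI[of _ "insert v B"] conjI ballI)
      show "insert v B \<subseteq> S" using vS B(1) by (auto simp: S'_def)
      show "pairwise orthogonal (insert v B)"
        using B(1,2) by (auto simp: pairwise_insert orthogonal_def S'_def inner_commute)
      show "norm b = 1" if "b \<in> insert v B" for b using that vv B(3) by auto
      show "\<exists>d. f b = d *\<^sub>R b" if "b \<in> insert v B" for b using that fv B(3) by auto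
      show "span (insert v B) = S"
      proof
        show "span (insert v B) \<subseteq> S"
          using vS B(1) less.prems(1) by (intro span_minimal) (auto simp: S'_def)
        show "S \<subseteq> span (insert v B)"
        proof
          fix x assume x: "x \<in> S"
          have "x - (x \<bullet> v) *\<^sub>R v \<in> S'"
            unfolding S'_def using x vS less.prems(1) vv
            by (auto intro: subspace_diff subspace_mul simp: inner_diff_left)
          then show "x \<in> span (insert v B)"
            unfolding span_insert B(4) by blast
        qed
      qed
    qed
  qed
qed

section \<open>Diagonalization and Sylvester's law of inertia\<close>

definition dg :: "(nat \<Rightarrow> real) \<Rightarrow> real mat" where
  "dg d = Matrix.mat 4 4 (\<lambda>(i,j). if i = j then d i else 0)"

lemma dg_carrier [simp]: "dg d \<in> carrier_mat 4 4"
  by (simp add: dg_def)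

lemma cong_mat_entry:
  assumes "P \<in> carrier_mat 4 4" "M \<in> carrier_mat 4 4"
  shows "cong_mat P M $$ (idx4 i, idx4 j) = lin P (axis i 1) \<bullet> lin M (lin P (axis j 1))"
proof -
  have "transpose_mat P * M \<in> carrier_mat 4 4" using assms by (intro mult_carrier_mat[of _ 4 4]) auto
  then have "lin P (axis i 1) \<bullet> lin M (lin P (axis j 1)) = axis i 1 \<bullet> lin (cong_mat P M) (axis j 1)"
    using assms by (simp add: cong_mat_def lin_mult inner_lin[of "transpose_mat P", symmetric])
  then show ?thesis by (simp add: inner_axis' lin_axis)
qed

text \<open>The columns of \<open>P\<close> are an orthonormal eigenbasis. Since \<open>P\<close> is
  orthogonal, the congruence is at the same time a similarity, which is what connects it with the
  characteristic polynomial.\<close>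

lemma symmetric_mat_diagonalize:
  assumes M: "M \<in> carrier_mat 4 4" "transpose_mat M = M"
  shows "\<exists>P d. P \<in> carrier_mat 4 4 \<and> transpose_mat P * P = 1\<^sub>m 4 \<and> cong_mat P M = dg d"
proof -
  have "lin M x \<bullet> y = x \<bullet> lin M y" for x y using inner_lin[OF M(1)] M(2) by simp
  from self_adjoint_eigenbasis[OF linear_lin this, of UNIV] obtain B where
    B: "pairwise orthogonal B" "\<And>b. b \<in> B \<Longrightarrow> norm b = 1 \<and> (\<exists>d. lin M b = d *\<^sub>R b)" "span B = UNIV"
    by auto
  have "0 \<notin> B" using B(2) by force
  then have "independent B" using B(1) pairwise_orthogonal_independent by blast
  then have "finite B" "card B = CARD(4)"
    using B(3) independent_imp_finite[of B] dim_eq_card_independent[of B] dim_span[of B] by auto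
  then obtain h :: "4 \<Rightarrow> real^4" where h: "bij_betw h UNIV B"
    using finite_same_card_bij[of "UNIV :: 4 set" B] by auto
  define P where "P = Matrix.mat 4 4 (\<lambda>(i,j). h (of_nat j) $ of_nat i)"
  have P: "P \<in> carrier_mat 4 4" by (simp add: P_def)
  have lP: "lin P (axis j 1) = h j" for j
    by (simp add: vec_eq_iff lin_axis P_def)
  have hB: "h j \<in> B" for j using h bij_betwE by blast
  have on: "h i \<bullet> h j = (if i = j then 1 else 0)" for i j
    using B(1) B(2)[OF hB] h unfolding pairwise_def orthogonal_def
    by (auto simp: norm_eq_1 bij_betw_def inj_eq hB)
  obtain d where d: "\<And>j. lin M (h j) = d j *\<^sub>R h j" using B(2)[OF hB] by metis
  have eqI: "X = Y" if "X \<in> carrier_mat 4 4" "Y \<in> carrier_mat 4 4" 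
    "\<And>i j. X $$ (idx4 i, idx4 j) = Y $$ (idx4 i, idx4 j)" for X Y :: "real mat"
  proof (rule eq_matI)
    fix i j assume "i < dim_row Y" "j < dim_col Y"
    then show "X $$ (i,j) = Y $$ (i,j)" using that(2) that(3)[of "of_nat i" "of_nat j"] by auto
  qed (use that in auto)
  have "transpose_mat P * P = cong_mat P (1\<^sub>m 4)" using P by (simp add: cong_mat_def)
  also have "\<dots> = 1\<^sub>m 4"
    using P inj_idx4 by (intro eqI) (auto simp: cong_mat_entry lP on inj_eq)
  finally have 1: "transpose_mat P * P = 1\<^sub>m 4" .
  have "cong_mat P M = dg (\<lambda>i. d (of_nat i))"
    using P M inj_idx4 by (intro eqI) (auto simp: cong_mat_entry lP on inj_eq d dg_def)
  then show ?thesis using P 1 by blast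
qed

lemma order_prod_linear: "order \<mu> (\<Prod>a\<leftarrow>xs. [:- a, 1:] :: real poly) = count_list xs \<mu>"
proof (induction xs)
  case Nil
  then show ?case by (simp add: order_1_eq_0)
next
  case (Cons a xs)
  have nz: "(\<Prod>a\<leftarrow>xs. [:- a, 1:] :: real poly) \<noteq> 0" by (auto simp: prod_list_zero_iff)
  have "order \<mu> [:- a, 1:] = (if a = \<mu> then 1 else 0)"
    using order_power_n_n[of \<mu> 1] by (auto intro: order_0I)
  then show ?case using Cons nz by (simp add: order_mult del: mult_pCons_left)
qed

text \<open>The order of a root of a product of linear factors is its number of occurrences in the
  list, so the sum of orders counts the positive entries with repetition.\<close>

lemma pos_eigs_prod:
  assumes "char_poly M = (\<Prod>a\<leftarrow>xs. [:- a, 1:])"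
  shows "pos_eigs M = length (filter (\<lambda>x. x > 0) xs)"
proof -
  have "poly (char_poly M) \<mu> = 0 \<longleftrightarrow> \<mu> \<in> set xs" for \<mu>
    unfolding assms by (induction xs) auto
  then have "pos_eigs M = (\<Sum>\<mu>\<in>{\<mu>. 0 < \<mu> \<and> \<mu> \<in> set xs}. count_list xs \<mu>)"
    by (simp add: pos_eigs_def assms order_prod_linear)
  also have "\<dots> = (\<Sum>\<mu>\<in>set (filter (\<lambda>x. x > 0) xs). count_list (filter (\<lambda>x. x > 0) xs) \<mu>)"
  proof (rule sum.cong)
    have "count_list xs \<mu> = count_list (filter (\<lambda>x. x > 0) xs) \<mu>" if "\<mu> > 0" for \<mu>
      using that by (induction xs) auto
    then show "\<And>x. x \<in> set (filter (\<lambda>x. x > 0) xs) \<Longrightarrow> count_list xs x = count_list (filter (\<lambda>x. x > 0) xs) x" by auto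
  qed auto
  finally show ?thesis by (simp add: sum_count_set)
qed

lemma qf_dg: "qf (dg d) x = (\<Sum>i\<in>UNIV. d (idx4 i) * (x $ i)\<^sup>2)"
proof -
  have E: "dg d $$ (idx4 i, idx4 j) = (if i = j then d (idx4 i) else 0)" for i j
    using inj_idx4 by (auto simp: dg_def inj_eq)
  show ?thesis
    by (simp add: E qf_def sum_lessThan_4_UNIV if_distrib if_distribR sum.delta power2_eq_square mult_ac cong: if_cong)
qed

text \<open>One half of Sylvester's law. The quadratic form of \<open>M\<close> is positive on
  \<open>?V\<close> away from 0 and at most 0 on \<open>?W\<close>, so these subspaces meet only in
  0 and their dimensions add up to at most 4. Exchanging the two diagonalizations gives
  equality.\<close>

lemma inertia_le:
  assumes M: "M \<in> carrier_mat 4 4" 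
    and P: "P \<in> carrier_mat 4 4" "Determinant.det P \<noteq> 0" "cong_mat P M = dg d"
    and Q: "Q \<in> carrier_mat 4 4" "Determinant.det Q \<noteq> 0" "cong_mat Q M = dg f"
  shows "card {i::4. d (idx4 i) > 0} \<le> card {i::4. f (idx4 i) > 0}"
proof -
  let ?D = "{i::4. d (idx4 i) > 0}" and ?F = "{i::4. f (idx4 i) > 0}"
  let ?VA = "{x::real^4. \<forall>i. i \<notin> ?D \<longrightarrow> x $ i = 0}"
  let ?WA = "{x::real^4. \<forall>i. i \<notin> - ?F \<longrightarrow> x $ i = 0}"
  let ?V = "lin P ` ?VA" and ?W = "lin Q ` ?WA"
  have s: "subspace ?VA" "subspace ?WA" by (auto simp: subspace_def)
  have dV: "dim ?V = card ?D"
    using dim_image_eq[OF linear_lin, of P ?VA] inj_lin[OF P(1,2)] dim_substandard_cart[of ?D, where 'a = real]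
    by (simp add: dim_vec_eq inj_on_subset)
  have dW: "dim ?W = card (- ?F)"
    using dim_image_eq[OF linear_lin, of Q ?WA] inj_lin[OF Q(1,2)] dim_substandard_cart[of "- ?F", where 'a = real]
    by (simp add: dim_vec_eq inj_on_subset)
  have int: "?V \<inter> ?W \<subseteq> {0}"
  proof
    fix z assume "z \<in> ?V \<inter> ?W"
    then obtain x y where x: "x \<in> ?VA" "z = lin P x" and y: "y \<in> ?WA" "z = lin Q y" by auto
    have "qf M z = (\<Sum>i\<in>UNIV. d (idx4 i) * (x $ i)\<^sup>2)"
      using qf_cong_mat[OF P(1) M, of x] by (simp add: P(3) qf_dg x(2))
    moreover have "qf M z = (\<Sum>i\<in>UNIV. f (idx4 i) * (y $ i)\<^sup>2)"
      using qf_cong_mat[OF Q(1) M, of y] by (simp add: Q(3) qf_dg y(2))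
    moreover have "(\<Sum>i\<in>UNIV. f (idx4 i) * (y $ i)\<^sup>2) \<le> 0"
    proof (rule sum_nonpos)
      fix i show "f (idx4 i) * (y $ i)\<^sup>2 \<le> 0"
        using y(1) by (cases "f (idx4 i) > 0") (auto simp: mult_nonpos_nonneg)
    qed
    ultimately have le: "(\<Sum>i\<in>UNIV. d (idx4 i) * (x $ i)\<^sup>2) \<le> 0" by simp
    have nn: "d (idx4 i) * (x $ i)\<^sup>2 \<ge> 0" for i
      using x(1) by (cases "d (idx4 i) > 0") auto
    have "x $ i = 0" for i
    proof -
      have "d (idx4 i) * (x $ i)\<^sup>2 = 0"
        using le nn sum_nonneg_eq_0_iff[of UNIV "\<lambda>i. d (idx4 i) * (x $ i)\<^sup>2"]
        by (metis (no_types, lifting) UNIV_I finite order_antisym sum_nonneg)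
      then show ?thesis using x(1) by (cases "d (idx4 i) > 0") auto
    qed
    then have "x = 0" by (simp add: vec_eq_iff)
    then show "z \<in> {0}" using x(2) linear_0[OF linear_lin] by simp
  qed
  have "subspace ?V" "subspace ?W" by (intro linear_subspace_image linear_lin s)+
  from dim_sums_Int[OF this] have "dim ?V + dim ?W = dim {x + y |x y. x \<in> ?V \<and> y \<in> ?W} + dim (?V \<inter> ?W)" by simp
  also have "dim (?V \<inter> ?W) = 0" using int by (simp add: dim_eq_0)
  also have "dim {x + y |x y. x \<in> ?V \<and> y \<in> ?W} \<le> DIM(real^4)" by (rule dim_subset_UNIV)
  finally have "card ?D + card (- ?F) \<le> 4" unfolding dV dW by simp
  moreover have "card (- ?F) + card ?F = 4"
    using card_Un_disjoint[of "- ?F" ?F] by (simp add: Compl_partition2)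
  ultimately show ?thesis by simp
qed

text \<open>The entries of \<open>f\<close> need not be eigenvalues. An orthogonal diagonalization
  exhibits the eigenvalues, and inertia compares their signs with those of \<open>f\<close>.\<close>

lemma pos_eigs_cong_mat:
  assumes M: "M \<in> carrier_mat 4 4" "transpose_mat M = M"
    and Q: "Q \<in> carrier_mat 4 4" "Determinant.det Q \<noteq> 0" "cong_mat Q M = dg f"
  shows "pos_eigs M = of_bool (f 0 > 0) + of_bool (f 1 > 0) + of_bool (f 2 > 0) + of_bool (f 3 > 0)"
proof -
  have cnt: "card {i::4. g (idx4 i) > 0} = of_bool (g 0 > 0) + of_bool (g 1 > 0) + of_bool (g 2 > 0) + of_bool (g 3 > 0)"
    for g :: "nat \<Rightarrow> real"
  proof -
    have "card {i::4. g (idx4 i) > 0} = (\<Sum>i\<in>(UNIV::4 set). of_bool (g (idx4 i) > 0))"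
      by (simp add: of_bool_def sum.If_cases)
    then show ?thesis by (simp add: sum_UNIV_4 idx4_def)
  qed
  obtain P d where P: "P \<in> carrier_mat 4 4" "transpose_mat P * P = 1\<^sub>m 4" "cong_mat P M = dg d"
    using symmetric_mat_diagonalize[OF M] by blast
  have P': "P * transpose_mat P = 1\<^sub>m 4" using P mat_mult_left_right_inverse[of "transpose_mat P" 4 P] by simp
  have dP: "Determinant.det P \<noteq> 0"
    using P by (metis Determinant.det_mult Determinant.det_one mult_zero_right transpose_carrier_mat zero_neq_one)
  have "similar_mat (dg d) M"
    unfolding similar_mat_def similar_mat_wit_def
    using P P' M by (intro exI[of _ "transpose_mat P"] exI[of _ P]) (auto simp: cong_mat_def dg_def)
  then have "char_poly M = char_poly (dg d)" using char_poly_similar by metis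
  also have "\<dots> = (\<Prod>a\<leftarrow>diag_mat (dg d). [:- a, 1:])"
    by (rule char_poly_upper_triangular[of _ 4]) (auto simp: upper_triangular_def dg_def)
  also have "diag_mat (dg d) = [d 0, d 1, d 2, d 3]"
    by (simp add: diag_mat_def dg_def upt_rec numeral_2_eq_2 numeral_3_eq_3)
  finally have "char_poly M = (\<Prod>a\<leftarrow>[d 0, d 1, d 2, d 3]. [:- a, 1:])" .
  from pos_eigs_prod[OF this] have "pos_eigs M = card {i::4. d (idx4 i) > 0}"
    unfolding cnt by simp
  also have "\<dots> = card {i::4. f (idx4 i) > 0}"
    using inertia_le[OF M(1) P(1) dP P(3) Q] inertia_le[OF M(1) Q P(1) dP P(3)] by simp
  finally show ?thesis by (simp add: cnt)
qed

section \<open>Index sequences\<close>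

definition low :: "real \<Rightarrow> real mat" where
  "low t = Matrix.mat 4 4 (\<lambda>(i,j). if i = j then 1 else if (i,j) = (1,0) then t else 0)"

lemma low_carrier [simp]: "low t \<in> carrier_mat 4 4"
  by (simp add: low_def)

lemma det_low: "Determinant.det (low t) = 1"
proof -
  have "Determinant.det (low t) = prod_list (diag_mat (low t))"
    by (rule det_lower_triangular[of 4]) (auto simp: low_def)
  also have "diag_mat (low t) = [1, 1, 1, 1]"
    by (simp add: diag_mat_def low_def upt_rec)
  finally show ?thesis by simp
qed

text \<open>Completing the square in the second coordinate:
  \<open>2 * p * x * y + q * y\<^sup>2\<close> is
  \<open>q * (y + p / q * x)\<^sup>2 - p\<^sup>2 / q * x\<^sup>2\<close>, hence the shear by
  \<open>- p / q\<close>.\<close>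

lemma cong_low_blk:
  assumes "q \<noteq> 0"
  shows "cong_mat (low (- p / q)) (blk p q r s) = dg (\<lambda>i. [- (p\<^sup>2 / q), q, r, s] ! i)"
    (is "?L = ?R")
proof (rule eq_matI)
  fix i j assume "i < dim_row ?R" "j < dim_col ?R"
  then have ij: "i < 4" "j < 4" by (auto simp: dg_def)
  have X: "(Matrix.transpose_mat (low (- p / q)) * blk p q r s) \<in> carrier_mat 4 4"
    by (rule mult_carrier_mat[of _ 4 4]) simp_all
  show "?L $$ (i,j) = ?R $$ (i,j)"
    unfolding cong_mat_def
    apply (subst index_mult_mat_4[OF X low_carrier ij])
    apply (subst index_mult_mat_4, simp, simp, rule ij, simp)+
    using ij unfolding less_4_cases
    apply (elim disjE)
    using assms
    apply (simp_all add: low_def blk_def dg_def power2_eq_square numeral_2_eq_2 numeral_3_eq_3)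
    done
qed (auto simp: cong_mat_def dg_def low_def)

lemma transpose_lincomb:
  assumes "A \<in> carrier_mat n n" "B \<in> carrier_mat n n" "transpose_mat A = A" "transpose_mat B = B"
  shows "transpose_mat (\<alpha> \<cdot>\<^sub>m A + \<beta> \<cdot>\<^sub>m B :: real mat) = \<alpha> \<cdot>\<^sub>m A + \<beta> \<cdot>\<^sub>m B"
proof -
  have "M $$ (j,i) = M $$ (i,j)" if "M \<in> carrier_mat n n" "transpose_mat M = M" "i < n" "j < n" for M :: "real mat" and i j
    using that by (metis carrier_matD index_transpose_mat(1))
  then show ?thesis using assms by (intro eq_matI) auto
qed

text \<open>After completing the square, the block of the double root has diagonal entries
  \<open>e1 * (l - a)\<^sup>2\<close> and \<open>- e1\<close>. They have opposite signs, so this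
  block always contributes the constant 1; only the simple roots make the index vary.\<close>

lemma Idx_canon211:
  assumes A: "A \<in> carrier_mat 4 4" "transpose_mat A = A" and B: "B \<in> carrier_mat 4 4" "transpose_mat B = B"
    and can: "canon211 A B a b c e1 e2 e3" and e1: "e1 \<noteq> 0" and l: "l \<noteq> a"
  shows "Idx A B l = 1 + of_bool (e2 * (l - b) > 0) + of_bool (e3 * (l - c) > 0)"
proof -
  obtain Q where Q: "Q \<in> carrier_mat 4 4" "Determinant.det Q \<noteq> 0" "cong_mat Q A = blk e1 0 e2 e3"
       "cong_mat Q B = blk (e1 * a) e1 (e2 * b) (e3 * c)"
    using can unfolding canon211_iff by blast
  define M where "M = l \<cdot>\<^sub>m A + (-1) \<cdot>\<^sub>m B"
  have lAB: "l \<cdot>\<^sub>m A - B = M" unfolding M_def using A B by (intro eq_matI) auto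
  have M: "M \<in> carrier_mat 4 4" "transpose_mat M = M"
    using A B by (auto simp: M_def transpose_lincomb)
  have QM: "cong_mat Q M = blk (e1 * (l - a)) (- e1) (e2 * (l - b)) (e3 * (l - c))"
    unfolding M_def using Q A B by (simp add: cong_mat_lincomb blk_lincomb) (simp add: algebra_simps)
  define R where "R = Q * low (- (e1 * (l - a)) / (- e1))"
  have R: "R \<in> carrier_mat 4 4" "Determinant.det R \<noteq> 0"
    using Q by (auto simp: R_def Determinant.det_mult[of _ 4] det_low)
  have "cong_mat R M = dg (\<lambda>i. [- ((e1 * (l - a))\<^sup>2 / - e1), - e1, e2 * (l - b), e3 * (l - c)] ! i)"
    unfolding R_def cong_mat_mult[OF Q(1) low_carrier M(1)] QM using e1 by (intro cong_low_blk) simp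
  from pos_eigs_cong_mat[OF M R this]
  have "Idx A B l = of_bool (- ((e1 * (l - a))\<^sup>2 / - e1) > 0) + of_bool (- e1 > 0)
      + of_bool (e2 * (l - b) > 0) + of_bool (e3 * (l - c) > 0)"
    by (simp add: Idx_def lAB numeral_2_eq_2 numeral_3_eq_3)
  also have "of_bool (- ((e1 * (l - a))\<^sup>2 / - e1) > 0) + of_bool (- e1 > 0) = (1::nat)"
  proof -
    have "- ((e1 * (l - a))\<^sup>2 / - e1) = e1 * (l - a)\<^sup>2" using e1 by (simp add: power2_eq_square)
    moreover have "(l - a)\<^sup>2 > 0" using l by simp
    ultimately show ?thesis using e1 by (auto simp: zero_less_mult_iff)
  qed
  finally show ?thesis .
qed

text \<open>A simple root with sign -1 is counted below the root, one with sign 1 above it. The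
  first two numbers coincide because both intervals lie below \<open>b\<close> and
  \<open>c\<close>.\<close>

lemma has_iseq_I:
  assumes A: "A \<in> carrier_mat 4 4" "transpose_mat A = A" and B: "B \<in> carrier_mat 4 4" "transpose_mat B = B"
    and can: "canon211 A B a b c e1 e2 e3" and ord: "a < b" "b < c"
    and e: "e1 \<in> {-1,1}" "e2 \<in> {-1,1}" "e3 \<in> {-1,1}"
  shows "has_iseq A B (1 + of_bool (e2 = -1) + of_bool (e3 = -1),
    [([Wr (e1 = 1), Wr (e1 = 1)], 1 + of_bool (e2 = -1) + of_bool (e3 = -1)),
     ([Bar], 1 + of_bool (e2 = 1) + of_bool (e3 = -1)),
     ([Bar], 1 + of_bool (e2 = 1) + of_bool (e3 = 1))])"
proof -
  have e1: "e1 \<noteq> 0" using e by auto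
  note I = Idx_canon211[OF A B can e1]
  show ?thesis
    unfolding has_iseq_def
    apply (rule exI[of _ a], rule exI[of _ b], rule exI[of _ c],
        rule exI[of _ e1], rule exI[of _ e2], rule exI[of _ e3])
    using e ord can by (auto simp: I)
qed

text \<open>The last two indices are enough to recover both signs of the simple roots, and the
  subscript \<open>s\<close> gives the remaining one. The roots in \<open>has_iseq\<close> come
  unordered, so the simple ones may have to be exchanged.\<close>

lemma has_iseq_D:
  assumes A: "A \<in> carrier_mat 4 4" "transpose_mat A = A" and B: "B \<in> carrier_mat 4 4" "transpose_mat B = B"
    and iseq: "has_iseq A B (n0, [([Wr s, Wr s], n1), ([Bar], n2), ([Bar], n3)])"
  shows "\<exists>a b c e2 e3. a < b \<and> b < c \<and> e2 \<in> {-1,1} \<and> e3 \<in> {-1,1} \<and>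
    canon211 A B a b c (if s then 1 else -1) e2 e3 \<and>
    n2 = 1 + of_bool (e2 = 1) + of_bool (e3 = -1) \<and> n3 = 1 + of_bool (e2 = 1) + of_bool (e3 = 1)"
proof -
  obtain a b c e1 e2 e3 where d: "distinct [a,b,c]"
    and e: "e1 \<in> {-1,1}" "e2 \<in> {-1,1}" "e3 \<in> {-1,1}"
    and can: "canon211 A B a b c e1 e2 e3"
    and S: "let r = sort [a,b,c]; sg = (\<lambda>x. if x = a then [Wr (e1 = 1), Wr (e1 = 1)] else [Bar])
        in (n0, [([Wr s, Wr s], n1), ([Bar], n2), ([Bar], n3)]) = (Idx A B (r!0 - 1),
                [(sg (r!0), Idx A B ((r!0 + r!1)/2)),
                 (sg (r!1), Idx A B ((r!1 + r!2)/2)),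
                 (sg (r!2), Idx A B (r!2 + 1))])"
    using iseq unfolding has_iseq_def by blast
  have e1: "e1 \<noteq> 0" using e by auto
  \<comment> \<open>Wriggles are attached to \<open>a\<close> only, and here they come first, so
    \<open>a\<close> heads the sorted list.\<close>
  have s0: "sort [a,b,c] ! 0 = a" and s: "(e1 = 1) = s"
    and n2: "n2 = Idx A B ((sort [a,b,c] ! 1 + sort [a,b,c] ! 2) / 2)"
    and n3: "n3 = Idx A B (sort [a,b,c] ! 2 + 1)"
    using S unfolding Let_def by (auto split: if_splits)
  have e1s: "e1 = (if s then 1 else -1)" using s e by auto
  have ab: "a < b" "a < c" using s0 d by (auto split: if_splits)
  note I = Idx_canon211[OF A B _ e1]
  consider "b < c" | "c < b" using d by fastforce
  then show ?thesis
  proof cases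
    case 1
    then have "sort [a,b,c] = [a,b,c]" using ab by simp
    then have "n2 = Idx A B ((b + c) / 2)" "n3 = Idx A B (c + 1)" using n2 n3 by (simp_all add: numeral_2_eq_2)
    then have "n2 = 1 + of_bool (e2 = 1) + of_bool (e3 = -1)" "n3 = 1 + of_bool (e2 = 1) + of_bool (e3 = 1)"
      using ab 1 e by (auto simp: I[OF can])
    then show ?thesis using ab 1 e can unfolding e1s
      by (intro exI[of _ a] exI[of _ b] exI[of _ c] exI[of _ e2] exI[of _ e3] conjI) assumption+
  next
    case 2
    have can': "canon211 A B a c b e1 e3 e2" by (rule canon211_swap[OF A(1) B(1) can])
    have "sort [a,b,c] = [a,c,b]" using ab 2 by simp
    then have "n2 = Idx A B ((c + b) / 2)" "n3 = Idx A B (b + 1)" using n2 n3 by (simp_all add: numeral_2_eq_2)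
    then have "n2 = 1 + of_bool (e3 = 1) + of_bool (e2 = -1)" "n3 = 1 + of_bool (e3 = 1) + of_bool (e2 = 1)"
      using ab 2 e by (auto simp: I[OF can'])
    then show ?thesis using ab 2 e can' unfolding e1s
      by (intro exI[of _ a] exI[of _ c] exI[of _ b] exI[of _ e3] exI[of _ e2] conjI) assumption+
  qed
qed

section \<open>Choosing a good basis of the pencil\<close>

text \<open>If \<open>b\<close> and \<open>c\<close> lie on different sides of \<open>a\<close>, the pole of the Moebius map is put between them.\<close>

lemma moebius_normalize:
  fixes a b c :: real
  assumes "distinct [a, b, c]"
  shows "\<exists>\<alpha> \<beta> \<gamma> \<delta>. \<alpha> * \<delta> - \<beta> * \<gamma> \<noteq> 0 \<and> \<alpha> + \<beta> * a \<noteq> 0 \<and> \<alpha> + \<beta> * b \<noteq> 0 \<and> \<alpha> + \<beta> * c \<noteq> 0 \<and>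
     \<gamma> + \<delta> * a = 0 \<and> (\<gamma> + \<delta> * b) / (\<alpha> + \<beta> * b) > 0 \<and> (\<gamma> + \<delta> * c) / (\<alpha> + \<beta> * c) > 0 \<and>
     (\<gamma> + \<delta> * b) / (\<alpha> + \<beta> * b) \<noteq> (\<gamma> + \<delta> * c) / (\<alpha> + \<beta> * c)"
proof -
  \<comment> \<open>Only the denominator has to be found. The numerator
    \<open>s * (\<lambda> - a)\<close> sends \<open>a\<close> to 0; \<open>pos\<close> says that the
    images of \<open>b\<close> and \<open>c\<close> then have a common sign, and \<open>s\<close>
    makes it positive.\<close>
  have *: ?thesis if nz: "\<alpha> + \<beta> * a \<noteq> 0" "\<alpha> + \<beta> * b \<noteq> 0" "\<alpha> + \<beta> * c \<noteq> 0"
    and pos: "((b - a) * (\<alpha> + \<beta> * b)) * ((c - a) * (\<alpha> + \<beta> * c)) > 0" for \<alpha> \<beta>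
  proof -
    define s where "s = sgn ((b - a) * (\<alpha> + \<beta> * b))"
    have dv: "x / y > 0" if "x * y > 0" for x y :: real
      using that by (simp add: zero_less_mult_iff zero_less_divide_iff)
    have s: "s \<noteq> 0" using assms nz unfolding s_def sgn_eq_0_iff by simp
    have "s * ((b - a) * (\<alpha> + \<beta> * b)) > 0" "s * ((c - a) * (\<alpha> + \<beta> * c)) > 0"
      using pos by (auto simp: s_def sgn_if zero_less_mult_iff mult_less_0_iff)
    then have 1: "s * (b - a) / (\<alpha> + \<beta> * b) > 0" "s * (c - a) / (\<alpha> + \<beta> * c) > 0"
      by (intro dv; simp only: mult.assoc)+
    \<comment> \<open>Injectivity of the Moebius map: the cross difference of the two images is
      \<open>b - c\<close> times the determinant
      \<open>s * (\<alpha> + \<beta> * a)\<close>.\<close>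
    have "(b - c) * (\<alpha> + \<beta> * a) \<noteq> 0" using assms nz by simp
    moreover have "s * (b - a) * (\<alpha> + \<beta> * c) - s * (c - a) * (\<alpha> + \<beta> * b) = s * ((b - c) * (\<alpha> + \<beta> * a))"
      by (simp add: algebra_simps)
    ultimately have "s * (b - a) * (\<alpha> + \<beta> * c) \<noteq> s * (c - a) * (\<alpha> + \<beta> * b)"
      using s by (metis mult_eq_0_iff right_minus_eq)
    then have 2: "s * (b - a) / (\<alpha> + \<beta> * b) \<noteq> s * (c - a) / (\<alpha> + \<beta> * c)"
      using nz by (simp add: frac_eq_eq)
    have 3: "- (s * a) + s * x = s * (x - a)" for x by (simp add: algebra_simps)
    have "\<alpha> * s - \<beta> * (- (s * a)) = s * (\<alpha> + \<beta> * a)" by (simp add: algebra_simps)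
    then have "\<alpha> * s - \<beta> * (- (s * a)) \<noteq> 0" using s nz by simp
    then show ?thesis
      using nz 1 2 by (intro exI[of _ \<alpha>] exI[of _ \<beta>] exI[of _ "- (s * a)"] exI[of _ s])
        (unfold 3, simp)
  qed
  show ?thesis
  proof (cases "(b - a) * (c - a) > 0")
    case True
    \<comment> \<open>Both simple roots lie on one side of \<open>a\<close>, so a constant
      denominator suffices.\<close>
    then show ?thesis using assms by (intro *[of 1 0]) auto
  next
    case False
    then have neg: "(b - a) * (c - a) < 0" using assms
      by (metis distinct_length_2_or_more linorder_neqE_linordered_idom mult_eq_0_iff right_minus_eq)
    \<comment> \<open>The pole \<open>m\<close> is the midpoint of \<open>b\<close> and
      \<open>c\<close>, unless that is \<open>a\<close> itself; then it moves to the quarter point,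
      since the pole must avoid \<open>a\<close>.\<close>
    define t :: real where "t = (if (b + c) / 2 = a then 1/4 else 1/2)"
    define m where "m = b + t * (c - b)"
    have t: "0 < t" "t < 1" by (auto simp: t_def)
    have ma: "m \<noteq> a"
    proof (cases "(b + c) / 2 = a")
      case True
      then have "m - a = (b - c) / 4" by (simp add: m_def t_def field_simps)
      then show ?thesis using assms by auto
    next
      case False
      then show ?thesis by (auto simp: m_def t_def field_simps)
    qed
    have mb: "b - m = t * (b - c)" "c - m = (1 - t) * (c - b)" by (auto simp: m_def algebra_simps)
    have "(b - m) * (c - m) = - (t * (1 - t) * (b - c)\<^sup>2)"
      unfolding mb by (simp add: algebra_simps power2_eq_square)
    also have "\<dots> < 0" using t assms by simp
    finally have "((b - a) * (c - a)) * ((b - m) * (c - m)) > 0" using neg by (simp add: mult_neg_neg)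
    then show ?thesis
      using ma mb t assms by (intro *[of "- m" 1]) (auto simp: mult_ac)
  qed
qed

text \<open>A Moebius map sends the double root to 0 and the simple ones to distinct positive
  numbers. A common sign change of both forms then makes the sign of the smaller simple root 1; the
  other two signs stay free.\<close>

lemma canon211_normalize:
  assumes A: "A \<in> carrier_mat 4 4" and B: "B \<in> carrier_mat 4 4"
    and can: "canon211 A B a b c e1 e2 e3"
    and e: "e1 \<in> {-1,1}" "e2 \<in> {-1,1}" "e3 \<in> {-1,1}" and d: "distinct [a,b,c]"
  shows "\<exists>\<alpha> \<beta> \<gamma> \<delta> a' b' c' e1' e3'. \<alpha> * \<delta> - \<beta> * \<gamma> \<noteq> 0 \<and> a' < b' \<and> b' < c' \<and>
    e1' \<in> {-1,1} \<and> e3' \<in> {-1,1} \<and>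
    canon211 (\<alpha> \<cdot>\<^sub>m A + \<beta> \<cdot>\<^sub>m B) (\<gamma> \<cdot>\<^sub>m A + \<delta> \<cdot>\<^sub>m B) a' b' c' e1' 1 e3'"
proof -
  have *: "\<exists>\<alpha> \<beta> \<gamma> \<delta> a' b' c' e1' e3'. \<alpha> * \<delta> - \<beta> * \<gamma> \<noteq> 0 \<and> a' < b' \<and> b' < c' \<and>
    e1' \<in> {-1,1} \<and> e3' \<in> {-1,1} \<and>
    canon211 (\<alpha> \<cdot>\<^sub>m A + \<beta> \<cdot>\<^sub>m B) (\<gamma> \<cdot>\<^sub>m A + \<delta> \<cdot>\<^sub>m B) a' b' c' e1' 1 e3'"
    if m: "\<alpha> * \<delta> - \<beta> * \<gamma> \<noteq> 0" "\<alpha> + \<beta> * a \<noteq> 0" "\<alpha> + \<beta> * b \<noteq> 0" "\<alpha> + \<beta> * c \<noteq> 0"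
      "\<gamma> + \<delta> * a = 0" "(\<gamma> + \<delta> * b) / (\<alpha> + \<beta> * b) > 0"
      "(\<gamma> + \<delta> * b) / (\<alpha> + \<beta> * b) < (\<gamma> + \<delta> * c) / (\<alpha> + \<beta> * c)"
      and can: "canon211 A B a b c e1 e2 e3" and e: "e1 \<in> {-1,1}" "e2 \<in> {-1,1}" "e3 \<in> {-1,1}"
    for \<alpha> \<beta> \<gamma> \<delta> a b c e1 e2 e3
  proof -
    \<comment> \<open>Scaling all four coefficients by \<open>\<tau>\<close>, which is 1 or -1,
      fixes the roots and reverses the three signs together when it is -1; the choice makes the
      second sign 1.\<close>
    define \<tau> where "\<tau> = sgn (e2 * (\<alpha> + \<beta> * b))"
    have e0: "e1 \<noteq> 0" "e2 \<noteq> 0" "e3 \<noteq> 0" using e by auto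
    have t: "\<tau> \<noteq> 0" using e0 m by (auto simp: \<tau>_def sgn_if)
    have f: "\<tau> * \<alpha> + \<tau> * \<beta> * x = \<tau> * (\<alpha> + \<beta> * x)" for \<alpha> \<beta> x :: real by (simp add: algebra_simps)
    have D: "\<tau> * \<alpha> * (\<tau> * \<delta>) - \<tau> * \<beta> * (\<tau> * \<gamma>) = \<tau>\<^sup>2 * (\<alpha> * \<delta> - \<beta> * \<gamma>)"
      by (simp add: algebra_simps power2_eq_square)
    have D0: "\<tau> * \<alpha> * (\<tau> * \<delta>) - \<tau> * \<beta> * (\<tau> * \<gamma>) \<noteq> 0" unfolding D using t m by simp
    define E1 where "E1 = sgn (e1 * (\<tau> * \<alpha> * (\<tau> * \<delta>) - \<tau> * \<beta> * (\<tau> * \<gamma>)) / (\<tau> * \<alpha> + \<tau> * \<beta> * a))"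
    define E3 where "E3 = sgn (e3 * (\<tau> * \<alpha> + \<tau> * \<beta> * c))"
    have E2: "sgn (e2 * (\<tau> * \<alpha> + \<tau> * \<beta> * b)) = 1"
      using e0 m unfolding f by (auto simp: \<tau>_def sgn_if zero_less_mult_iff mult_less_0_iff)
    have sg: "sgn x \<in> {-1,1}" if "x \<noteq> 0" for x :: real using that by (auto simp: sgn_if)
    have E: "E1 \<in> {-1,1}" "E3 \<in> {-1,1}"
      unfolding E1_def E3_def D f using t m e0 by (intro sg; simp)+
    have "canon211 ((\<tau> * \<alpha>) \<cdot>\<^sub>m A + (\<tau> * \<beta>) \<cdot>\<^sub>m B) ((\<tau> * \<gamma>) \<cdot>\<^sub>m A + (\<tau> * \<delta>) \<cdot>\<^sub>m B)
      ((\<tau> * \<gamma> + \<tau> * \<delta> * a) / (\<tau> * \<alpha> + \<tau> * \<beta> * a)) ((\<tau> * \<gamma> + \<tau> * \<delta> * b) / (\<tau> * \<alpha> + \<tau> * \<beta> * b))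
      ((\<tau> * \<gamma> + \<tau> * \<delta> * c) / (\<tau> * \<alpha> + \<tau> * \<beta> * c)) E1 1 E3"
      unfolding E1_def E3_def E2[symmetric]
      by (rule canon211_basis_change[OF A B can e0]) (use t m D0 in \<open>auto simp: f\<close>)
    then have can': "canon211 ((\<tau> * \<alpha>) \<cdot>\<^sub>m A + (\<tau> * \<beta>) \<cdot>\<^sub>m B) ((\<tau> * \<gamma>) \<cdot>\<^sub>m A + (\<tau> * \<delta>) \<cdot>\<^sub>m B)
      0 ((\<gamma> + \<delta> * b) / (\<alpha> + \<beta> * b)) ((\<gamma> + \<delta> * c) / (\<alpha> + \<beta> * c)) E1 1 E3"
      unfolding f using t m(5) by simp
    show ?thesis using can' E D0 m(6,7) by blast
  qed
  obtain \<alpha> \<beta> \<gamma> \<delta> where m: "\<alpha> * \<delta> - \<beta> * \<gamma> \<noteq> 0" "\<alpha> + \<beta> * a \<noteq> 0" "\<alpha> + \<beta> * b \<noteq> 0" "\<alpha> + \<beta> * c \<noteq> 0"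
      "\<gamma> + \<delta> * a = 0" "(\<gamma> + \<delta> * b) / (\<alpha> + \<beta> * b) > 0" "(\<gamma> + \<delta> * c) / (\<alpha> + \<beta> * c) > 0"
      "(\<gamma> + \<delta> * b) / (\<alpha> + \<beta> * b) \<noteq> (\<gamma> + \<delta> * c) / (\<alpha> + \<beta> * c)"
    using moebius_normalize[OF d] by blast
  show ?thesis
  proof (cases "(\<gamma> + \<delta> * b) / (\<alpha> + \<beta> * b) < (\<gamma> + \<delta> * c) / (\<alpha> + \<beta> * c)")
    case True
    show ?thesis by (rule *[OF m(1-6) True can e])
  next
    case False
    then have "(\<gamma> + \<delta> * c) / (\<alpha> + \<beta> * c) < (\<gamma> + \<delta> * b) / (\<alpha> + \<beta> * b)" using m(8) by simp
    then show ?thesis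
      by (rule *[OF m(1,2,4,3,5,7) _ canon211_swap[OF A B can] e(1,3,2)])
  qed
qed

text \<open>In the normalized basis \<open>e3' = 1\<close> gives the indices 1, 1, 2, 3 and
  \<open>e3' = -1\<close> gives 2, 2, 3, 2, while \<open>e1'\<close> is the subscript.\<close>

lemma iseq_equiv_cases:
  assumes A: "A \<in> carrier_mat 4 4" "transpose_mat A = A" and B: "B \<in> carrier_mat 4 4" "transpose_mat B = B"
    and can: "canon211 A B a b c e1 e2 e3"
    and e: "e1 \<in> {-1,1}" "e2 \<in> {-1,1}" "e3 \<in> {-1,1}" and d: "distinct [a,b,c]"
  shows "iseq_equiv A B S_22m \<or> iseq_equiv A B S_22p \<or> iseq_equiv A B S_11m \<or> iseq_equiv A B S_11p"
proof -
  obtain \<alpha> \<beta> \<gamma> \<delta> a' b' c' e1' e3' where n: "\<alpha> * \<delta> - \<beta> * \<gamma> \<noteq> 0" "a' < b'" "b' < c'"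
    "e1' \<in> {-1,1}" "e3' \<in> {-1,1}"
    "canon211 (\<alpha> \<cdot>\<^sub>m A + \<beta> \<cdot>\<^sub>m B) (\<gamma> \<cdot>\<^sub>m A + \<delta> \<cdot>\<^sub>m B) a' b' c' e1' 1 e3'"
    using canon211_normalize[OF A(1) B(1) can e d] by blast
  let ?A = "\<alpha> \<cdot>\<^sub>m A + \<beta> \<cdot>\<^sub>m B" and ?B = "\<gamma> \<cdot>\<^sub>m A + \<delta> \<cdot>\<^sub>m B"
  have cA: "?A \<in> carrier_mat 4 4" "transpose_mat ?A = ?A" and cB: "?B \<in> carrier_mat 4 4" "transpose_mat ?B = ?B"
    using A B transpose_lincomb[OF A(1) B(1) A(2) B(2)] by auto
  have "Determinant.det ?A \<noteq> 0" using canon211_imp_det[OF cA(1) n(6)] n by auto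
  then have equiv: "iseq_equiv A B S" if "has_iseq ?A ?B S" for S
    unfolding iseq_equiv_def using that n(1) by blast
  note I = has_iseq_I[OF cA cB n(6) n(2,3) n(4) _ n(5), THEN equiv]
  show ?thesis
    using I n(4,5) unfolding S_22m_def S_22p_def S_11m_def S_11p_def
    by (auto simp: numeral_2_eq_2 numeral_3_eq_3)
qed

section \<open>Topology of the intersection curve\<close>

text \<open>As \<open>F\<close> is finite, the union of the other members is closed too; a connected
  set that meets \<open>X\<close> therefore cannot leave it.\<close>

lemma components_Union_closed:
  fixes F :: "'a::topological_space set set"
  assumes fin: "finite F" and disj: "pairwise disjnt F"
    and F: "\<And>X. X \<in> F \<Longrightarrow> closed X \<and> connected X \<and> X \<noteq> {}"
  shows "components (\<Union>F) = F"
proof -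
  have *: "connected_component_set (\<Union>F) x = X" if X: "X \<in> F" "x \<in> X" for X x
  proof
    let ?C = "connected_component_set (\<Union>F) x" and ?R = "\<Union>(F - {X})"
    show "X \<subseteq> ?C" using F X by (intro connected_component_maximal) auto
    have "connected ?C" by (rule connected_connected_component)
    moreover have "closed X" "closed ?R" using F X fin by (auto intro: closed_Union)
    moreover have "?C \<subseteq> X \<union> ?R" using connected_component_subset[of "\<Union>F" x] by blast
    moreover have "X \<inter> ?R = {}" using disj X unfolding pairwise_def disjnt_def by blast
    moreover have "x \<in> X \<inter> ?C" using X by (auto intro: connected_component_refl)
    ultimately have "?R \<inter> ?C = {}" unfolding connected_closed by blast
    then show "?C \<subseteq> X" using \<open>?C \<subseteq> X \<union> ?R\<close> by blast
  qed
  show ?thesis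
  proof
    show "components (\<Union>F) \<subseteq> F" using * unfolding components_def by auto
    show "F \<subseteq> components (\<Union>F)"
    proof
      fix X assume X: "X \<in> F"
      then obtain x where "x \<in> X" using F by blast
      then show "X \<in> components (\<Union>F)" using *[OF X, of x] X unfolding components_def by blast
    qed
  qed
qed

lemma ellipse_connected_compact:
  fixes a b :: real
  assumes pos: "a > 0" "b > 0"
  defines "E \<equiv> {e. a * (fst e)\<^sup>2 + b * (snd e)\<^sup>2 = 1}"
  shows "connected E" "compact E" "E \<noteq> {}"
proof -
  let ?f = "\<lambda>t. (cos t / sqrt a, sin t / sqrt b)"
  have E: "E = ?f ` {0..2*pi}"
  proof
    show "?f ` {0..2*pi} \<subseteq> E"
      using pos by (auto simp: E_def power_divide)
    show "E \<subseteq> ?f ` {0..2*pi}"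
    proof
      fix e assume "e \<in> E"
      then have "(sqrt a * fst e)\<^sup>2 + (sqrt b * snd e)\<^sup>2 = 1"
        using pos by (simp add: E_def power_mult_distrib)
      then obtain t where t: "0 \<le> t" "t < 2 * pi" "sqrt a * fst e = cos t" "sqrt b * snd e = sin t"
        using sincos_total_2pi by metis
      have "fst e = cos t / sqrt a" "snd e = sin t / sqrt b"
        using pos by (simp_all flip: t(3,4))
      then have "e = ?f t" by (simp add: prod_eq_iff)
      moreover have "t \<in> {0..2*pi}" using t by simp
      ultimately show "e \<in> ?f ` {0..2*pi}" by blast
    qed
  qed
  have c: "continuous_on {0..2*pi} ?f"
    by (intro continuous_intros) (use pos in auto)
  show "connected E" unfolding E by (rule connected_continuous_image[OF c]) simp
  show "compact E" unfolding E by (rule compact_continuous_image[OF c]) simp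
  show "E \<noteq> {}" unfolding E by simp
qed

section \<open>Coordinates on \<open>real^4\<close> and values of the quadratic forms\<close>

definition vec4 :: "real \<Rightarrow> real \<Rightarrow> real \<Rightarrow> real \<Rightarrow> real^4" where
  "vec4 x y z w = (\<chi> i. if i = 0 then x else if i = 1 then y else if i = 2 then z else w)"

lemma vec4_nth [simp]: "vec4 x y z w $ 0 = x" "vec4 x y z w $ 1 = y" "vec4 x y z w $ 2 = z" "vec4 x y z w $ 3 = w"
  by (simp_all add: vec4_def)

lemma vec_eq_iff_4: "(x :: real^4) = y \<longleftrightarrow> x $ 0 = y $ 0 \<and> x $ 1 = y $ 1 \<and> x $ 2 = y $ 2 \<and> x $ 3 = y $ 3"
proof
  assume h: "x $ 0 = y $ 0 \<and> x $ 1 = y $ 1 \<and> x $ 2 = y $ 2 \<and> x $ 3 = y $ 3"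
  have "x $ i = y $ i" for i using exhaust_4'[of i] by (elim disjE) (simp_all add: h)
  then show "x = y" by (simp add: vec_eq_iff)
qed simp

lemma continuous_on_vec4 [continuous_intros]:
  assumes "continuous_on S f" "continuous_on S g" "continuous_on S h" "continuous_on S k"
  shows "continuous_on S (\<lambda>t. vec4 (f t) (g t) (h t) (k t))"
  unfolding vec4_def
proof (rule continuous_on_vec_lambda)
  show "continuous_on S (\<lambda>t. if i = 0 then f t else if i = 1 then g t else if i = 2 then h t else k t)" for i :: 4
    using assms by (cases "i = 0"; cases "i = 1"; cases "i = 2"; simp)
qed

lemma inner_vec4: "vec4 a b c d \<bullet> x = a * x $ 0 + b * x $ 1 + c * x $ 2 + d * x $ 3"
  by (simp add: inner_vec_def sum_UNIV_4)

lemma qf_scaleR: "qf A (c *\<^sub>R x) = c\<^sup>2 * qf A x"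
  by (simp add: qf_eq linear_cmul[OF linear_lin] power2_eq_square)

lemma qf_blk: "qf (blk p q r s) x = 2 * p * x $ 0 * x $ 1 + q * (x $ 1)\<^sup>2 + r * (x $ 2)\<^sup>2 + s * (x $ 3)\<^sup>2"
  by (simp add: qf_def sum_lessThan_4 blk_def algebra_simps power2_eq_square)

lemma lin_lincomb:
  assumes "A \<in> carrier_mat 4 4" "B \<in> carrier_mat 4 4"
  shows "lin (\<alpha> \<cdot>\<^sub>m A + \<beta> \<cdot>\<^sub>m B) x = \<alpha> *\<^sub>R lin A x + \<beta> *\<^sub>R lin B x"
  using assms by (simp add: lin_def vec_eq_iff distrib_right sum.distrib sum_distrib_left mult.assoc)

lemma qf_lincomb:
  assumes "A \<in> carrier_mat 4 4" "B \<in> carrier_mat 4 4"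
  shows "qf (\<alpha> \<cdot>\<^sub>m A + \<beta> \<cdot>\<^sub>m B) x = \<alpha> * qf A x + \<beta> * qf B x"
  using assms by (simp add: qf_eq lin_lincomb inner_add_right)

lemma qsic_singI:
  assumes A: "A \<in> carrier_mat 4 4" and B: "B \<in> carrier_mat 4 4"
    and p: "p \<in> qsic_sph A B" and nz: "(\<mu>, \<nu>) \<noteq> (0, 0)" and M: "lin (\<mu> \<cdot>\<^sub>m A + \<nu> \<cdot>\<^sub>m B) p = 0"
  shows "qsic_sing A B p"
proof -
  have "(\<Sum>j<4. (\<mu> * A $$ (i,j) + \<nu> * B $$ (i,j)) * p $ (of_nat j)) = 0" if "i < 4" for i
  proof -
    have "(\<Sum>j<4. (\<mu> * A $$ (i,j) + \<nu> * B $$ (i,j)) * p $ (of_nat j)) = lin (\<mu> \<cdot>\<^sub>m A + \<nu> \<cdot>\<^sub>m B) p $ of_nat i"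
      using that A B by (simp add: lin_def sum_lessThan_4_UNIV)
    then show ?thesis using M by simp
  qed
  then show ?thesis unfolding qsic_sing_def using p nz by blast
qed

section \<open>Passing from canonical coordinates to the unit sphere\<close>

locale frame =
  fixes Q :: "real mat"
  assumes Q: "Q \<in> carrier_mat 4 4" "Determinant.det Q \<noteq> 0"
begin

text \<open>The unit vector representing the point with canonical coordinates \<open>x\<close>. It
  forgets exactly a positive factor, so two parameters with equal or antipodal images can be
  compared by their coordinates.\<close>

definition N :: "real^4 \<Rightarrow> real^4" where
  "N x = lin Q x /\<^sub>R norm (lin Q x)"

lemma lin_eq_0 [simp]: "lin Q x = 0 \<longleftrightarrow> x = 0"
  using inj_lin[OF Q] linear_0[OF linear_lin] by (metis injD)

lemma norm_N: "x \<noteq> 0 \<Longrightarrow> norm (N x) = 1"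
  by (simp add: N_def)

lemma N_eqD:
  assumes "N x = N y" "x \<noteq> 0" "y \<noteq> 0"
  obtains l where "l > 0" "x = l *\<^sub>R y"
proof
  let ?l = "norm (lin Q x) / norm (lin Q y)"
  show "?l > 0" using assms by simp
  have "lin Q x = norm (lin Q x) *\<^sub>R N x" using assms(2) by (simp add: N_def)
  also have "\<dots> = norm (lin Q x) *\<^sub>R N y" using assms(1) by simp
  also have "\<dots> = ?l *\<^sub>R lin Q y" by (simp add: N_def divide_inverse)
  also have "\<dots> = lin Q (?l *\<^sub>R y)" by (simp add: linear_cmul[OF linear_lin])
  finally show "x = ?l *\<^sub>R y" using inj_lin[OF Q] by (metis injD)
qed

lemma N_scaleR_pos: "c > 0 \<Longrightarrow> N (c *\<^sub>R x) = N x"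
  by (simp add: N_def linear_cmul[OF linear_lin])

lemma N_uminus: "N (- x) = - N x"
  by (simp add: N_def linear_neg[OF linear_lin])

lemma N_scaleR_neg: "c < 0 \<Longrightarrow> N (c *\<^sub>R x) = - N x"
  by (metis N_scaleR_pos N_uminus minus_minus neg_0_less_iff_less scaleR_minus_left)

lemma N_neq_uminus:
  assumes "x \<noteq> 0"
  shows "N x \<noteq> - N x"
proof
  assume "N x = - N x"
  then have "N x \<bullet> N x = N x \<bullet> (- N x)" by (rule arg_cong)
  then show False using norm_N[OF assms] by (simp add: norm_eq_1)
qed

lemma continuous_on_N:
  assumes "continuous_on S f" "\<And>x. x \<in> S \<Longrightarrow> f x \<noteq> 0"
  shows "continuous_on S (\<lambda>x. N (f x))"
proof -
  have "continuous_on S (\<lambda>x. lin Q (f x))"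
    using assms(1) linear_lin[of Q]
    by (intro continuous_on_compose2[OF linear_continuous_on[of "lin Q" UNIV]]) (auto simp: linear_conv_bounded_linear)
  then show ?thesis unfolding N_def using assms(2) by (intro continuous_intros) auto
qed

text \<open>A plane missing the set may be sought in canonical coordinates: the inverse transpose of
  \<open>Q\<close> transports its linear form, and normalization only divides the value by a
  positive number.\<close>

lemma closed_comp_N:
  assumes "X \<noteq> {}" "\<And>x. x \<in> X \<Longrightarrow> g \<bullet> x \<noteq> 0"
  shows "closed_comp (N ` X \<union> uminus ` N ` X)"
proof -
  from det_non_zero_imp_unit[OF Q, unfolded Units_def ring_mat_def]
  obtain R where R: "R \<in> carrier_mat 4 4" "R * Q = 1\<^sub>m 4" by auto
  define h where "h = lin (transpose_mat R) g"
  have hx: "h \<bullet> N x = (g \<bullet> x) / norm (lin Q x)" for x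
  proof -
    have "h \<bullet> lin Q x = g \<bullet> x"
      using R Q lin_mult[of R Q x] by (simp add: h_def inner_lin)
    then show ?thesis by (simp add: N_def divide_inverse)
  qed
  have nz: "h \<bullet> N x \<noteq> 0" if "x \<in> X" for x
    using assms(2)[OF that] by (auto simp: hx)
  then have "h \<noteq> 0" using assms(1) by auto
  then show ?thesis unfolding closed_comp_def using nz by (intro exI[of _ h]) auto
qed

lemma qsic_sph_eq:
  assumes "\<And>x. (qf A (lin Q x) = 0 \<and> qf B (lin Q x) = 0) \<longleftrightarrow> x \<in> Z"
  shows "qsic_sph A B = N ` (Z - {0})"
proof
  show "N ` (Z - {0}) \<subseteq> qsic_sph A B"
  proof
    fix v assume "v \<in> N ` (Z - {0})"
    then obtain x where x: "x \<in> Z" "x \<noteq> 0" "v = N x" by blast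
    then have "qf A (lin Q x) = 0" "qf B (lin Q x) = 0" using assms by blast+
    then show "v \<in> qsic_sph A B" using norm_N x by (simp add: qsic_sph_def) (simp add: N_def qf_scaleR)
  qed
  show "qsic_sph A B \<subseteq> N ` (Z - {0})"
  proof
    fix v assume v: "v \<in> qsic_sph A B"
    from det_non_zero_imp_unit[OF Q, unfolded Units_def ring_mat_def]
    obtain R where R: "R \<in> carrier_mat 4 4" "Q * R = 1\<^sub>m 4" by auto
    have T: "lin Q (lin R v) = v" using lin_mult[OF Q(1) R(1), of v] R(2) by simp
    have "lin R v \<in> Z - {0}"
      using v assms[of "lin R v"] T linear_0[OF linear_lin] by (auto simp: qsic_sph_def)
    moreover have "N (lin R v) = v" using v by (simp add: N_def T qsic_sph_def)
    ultimately show "v \<in> N ` (Z - {0})" by (metis image_eqI)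
  qed
qed

end

text \<open>\<open>R\<close> collects the rest of the curve on the sphere. It has to contain
  \<open>- p\<close> when that lies on the curve: the same projective point, but a different unit
  vector.\<close>

lemma acnodeI:
  assumes "qsic_sing A B p" "qsic_sph A B \<subseteq> insert p R" "closed R" "p \<notin> R"
  shows "acnode A B p"
proof -
  obtain e where e: "e > 0" "ball p e \<subseteq> - R"
    using assms(3,4) open_contains_ball[of "- R"] by (metis ComplI open_Compl)
  have "p \<in> qsic_sph A B" using assms(1) by (simp add: qsic_sing_def)
  then have "ball p e \<inter> qsic_sph A B = {p}" using e assms(2) by auto
  then show ?thesis unfolding acnode_def using e assms(1) by blast
qed

text \<open>The second equation is positive definite in the last three coordinates, so its only real
  solutions are the multiples of the first basis vector, and these satisfy the first equation as
  well.\<close>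

lemma (in frame) one_point:
  assumes A: "A \<in> carrier_mat 4 4" and B: "B \<in> carrier_mat 4 4"
    and Z: "\<And>x. (qf A (lin Q x) = 0 \<and> qf B (lin Q x) = 0) \<longleftrightarrow>
        2 * x $ 0 * x $ 1 + (x $ 2)\<^sup>2 + (x $ 3)\<^sup>2 = 0 \<and> (x $ 1)\<^sup>2 + P * (x $ 2)\<^sup>2 + R * (x $ 3)\<^sup>2 = 0"
    and pos: "P > 0" "R > 0"
    and sing: "(\<mu>, \<nu>) \<noteq> (0, 0)" "lin (\<mu> \<cdot>\<^sub>m A + \<nu> \<cdot>\<^sub>m B) (lin Q (vec4 1 0 0 0)) = 0"
  shows "\<exists>p. qsic_sph A B = {p, - p} \<and> acnode A B p"
proof -
  define e0 where "e0 = vec4 1 0 0 0"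
  have e0: "e0 \<noteq> 0" by (simp add: e0_def vec_eq_iff_4)
  define Z0 where "Z0 = range (\<lambda>t. t *\<^sub>R e0)"
  have "(qf A (lin Q x) = 0 \<and> qf B (lin Q x) = 0) \<longleftrightarrow> x \<in> Z0" for x
  proof
    assume "qf A (lin Q x) = 0 \<and> qf B (lin Q x) = 0"
    then have s: "(x $ 1)\<^sup>2 + P * (x $ 2)\<^sup>2 + R * (x $ 3)\<^sup>2 = 0" using Z by simp
    moreover have "P * (x $ 2)\<^sup>2 \<ge> 0" "R * (x $ 3)\<^sup>2 \<ge> 0" "(x $ 1)\<^sup>2 \<ge> 0" using pos by auto
    ultimately have "(x $ 1)\<^sup>2 = 0" "P * (x $ 2)\<^sup>2 = 0" "R * (x $ 3)\<^sup>2 = 0" by linarith+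
    then have "x = (x $ 0) *\<^sub>R e0" using pos by (simp add: vec_eq_iff_4 e0_def)
    then show "x \<in> Z0" unfolding Z0_def by blast
  next
    assume "x \<in> Z0"
    then show "qf A (lin Q x) = 0 \<and> qf B (lin Q x) = 0" by (auto simp: Z Z0_def e0_def)
  qed
  from qsic_sph_eq[OF this] have S: "qsic_sph A B = N ` (Z0 - {0})" .
  also have "\<dots> = {N e0, - N e0}"
  proof
    show "N ` (Z0 - {0}) \<subseteq> {N e0, - N e0}"
    proof
      fix v assume "v \<in> N ` (Z0 - {0})"
      then obtain x where "x \<in> Z0" "x \<noteq> 0" "v = N x" by blast
      moreover from this obtain t where "x = t *\<^sub>R e0" by (auto simp: Z0_def)
      ultimately have "t \<noteq> 0" "v = N (t *\<^sub>R e0)" by auto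
      then show "v \<in> {N e0, - N e0}" using N_scaleR_pos[of t e0] N_scaleR_neg[of t e0]
        by (cases "t > 0") auto
    qed
    have "1 *\<^sub>R e0 \<in> Z0" "(-1) *\<^sub>R e0 \<in> Z0" unfolding Z0_def by (rule rangeI)+
    then have "1 *\<^sub>R e0 \<in> Z0 - {0}" "(-1) *\<^sub>R e0 \<in> Z0 - {0}" using e0 by auto
    then have "N (1 *\<^sub>R e0) \<in> N ` (Z0 - {0})" "N ((-1) *\<^sub>R e0) \<in> N ` (Z0 - {0})" by blast+
    then show "{N e0, - N e0} \<subseteq> N ` (Z0 - {0})" by (simp add: N_uminus)
  qed
  finally have S: "qsic_sph A B = {N e0, - N e0}" .
  have "lin (\<mu> \<cdot>\<^sub>m A + \<nu> \<cdot>\<^sub>m B) (N e0) = 0"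
    using sing(2) by (simp add: N_def e0_def linear_cmul[OF linear_lin])
  then have "qsic_sing A B (N e0)" using A B sing(1) S by (intro qsic_singI) auto
  moreover have "N e0 \<noteq> - N e0"
    by (rule N_neq_uminus[OF e0])
  ultimately have "acnode A B (N e0)" using S by (intro acnodeI[of _ _ _ "{- N e0}"]) auto
  then show ?thesis using S by blast
qed

text \<open>The oval is parametrized over an ellipse in the chart \<open>x $ 1 = 1\<close>.\<close>

lemma (in frame) oval_and_acnode:
  assumes A: "A \<in> carrier_mat 4 4" and B: "B \<in> carrier_mat 4 4"
    and Z: "\<And>x. (qf A (lin Q x) = 0 \<and> qf B (lin Q x) = 0) \<longleftrightarrow>
        2 * x $ 0 * x $ 1 = (x $ 2)\<^sup>2 + (x $ 3)\<^sup>2 \<and> (x $ 1)\<^sup>2 = P * (x $ 2)\<^sup>2 + R * (x $ 3)\<^sup>2"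
    and pos: "P > 0" "R > 0"
    and sing: "(\<mu>, \<nu>) \<noteq> (0, 0)" "lin (\<mu> \<cdot>\<^sub>m A + \<nu> \<cdot>\<^sub>m B) (lin Q (vec4 1 0 0 0)) = 0"
  shows "\<exists>C p. proj_components A B = {C, {p, -p}} \<and> C \<noteq> {p, -p} \<and>
                 closed_comp C \<and> \<not> (\<exists>q. C = {q, -q}) \<and> acnode A B p"
proof -
  define e0 where "e0 = vec4 1 0 0 0"
  have e0: "e0 \<noteq> 0" by (simp add: e0_def vec_eq_iff_4)
  define E where "E = {e. P * (fst e)\<^sup>2 + R * (snd e)\<^sup>2 = 1}"
  note E = ellipse_connected_compact[OF pos, folded E_def]
  \<comment> \<open>With second coordinate 1 the first equation gives the first coordinate, and the
    second equation says that the last two lie on the ellipse \<open>E\<close>.\<close>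
  define \<psi> where "\<psi> e = vec4 (((fst e)\<^sup>2 + (snd e)\<^sup>2) / 2) 1 (fst e) (snd e)" for e
  have \<psi>0: "\<psi> e \<noteq> 0" for e by (simp add: \<psi>_def vec_eq_iff_4)
  define X where "X = insert e0 (\<psi> ` E)"
  define K where "K = N ` \<psi> ` E"
  define Z0 where "Z0 = (\<lambda>(t,x). t *\<^sub>R x) ` (UNIV \<times> X)"
  have X0: "x \<noteq> 0" if "x \<in> X" for x using that \<psi>0 e0 by (auto simp: X_def)
  have "(qf A (lin Q x) = 0 \<and> qf B (lin Q x) = 0) \<longleftrightarrow> x \<in> Z0" for x
  proof
    assume "qf A (lin Q x) = 0 \<and> qf B (lin Q x) = 0"
    then have 1: "2 * x $ 0 * x $ 1 = (x $ 2)\<^sup>2 + (x $ 3)\<^sup>2"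
      and 2: "(x $ 1)\<^sup>2 = P * (x $ 2)\<^sup>2 + R * (x $ 3)\<^sup>2" using Z by auto
    show "x \<in> Z0"
    proof (cases "x $ 1 = 0")
      case True
      then have "x $ 2 = 0" "x $ 3 = 0" using 1 by (auto simp: sum_power2_eq_zero_iff)
      then have "x = (\<lambda>(t,x). t *\<^sub>R x) (x $ 0, e0)" using True by (simp add: vec_eq_iff_4 e0_def)
      then show ?thesis unfolding Z0_def X_def by blast
    next
      case False
      define e where "e = (x $ 2 / x $ 1, x $ 3 / x $ 1)"
      have "P * (fst e)\<^sup>2 + R * (snd e)\<^sup>2 = (P * (x $ 2)\<^sup>2 + R * (x $ 3)\<^sup>2) / (x $ 1)\<^sup>2"
        by (simp add: e_def power_divide add_divide_distrib)
      then have "e \<in> E" using False by (simp add: E_def 2[symmetric])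
      moreover have "((fst e)\<^sup>2 + (snd e)\<^sup>2) / 2 * x $ 1 = x $ 0"
      proof -
        have "((fst e)\<^sup>2 + (snd e)\<^sup>2) = (2 * x $ 0 * x $ 1) / (x $ 1)\<^sup>2"
          unfolding 1 by (simp add: e_def power_divide add_divide_distrib)
        then show ?thesis using False by (simp add: power2_eq_square)
      qed
      then have "x = (\<lambda>(t,x). t *\<^sub>R x) (x $ 1, \<psi> e)"
        using False by (simp add: vec_eq_iff_4 \<psi>_def mult.commute) (simp add: e_def)
      ultimately show ?thesis unfolding Z0_def X_def by blast
    qed
  next
    assume "x \<in> Z0"
    then obtain t y where x: "x = t *\<^sub>R y" and y: "y \<in> X" by (auto simp: Z0_def)
    show "qf A (lin Q x) = 0 \<and> qf B (lin Q x) = 0"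
    proof (cases "y = e0")
      case True
      then show ?thesis by (simp add: Z x e0_def)
    next
      case False
      then obtain e where e: "y = \<psi> e" "P * (fst e)\<^sup>2 + R * (snd e)\<^sup>2 = 1"
        using y by (auto simp: X_def E_def)
      have "P * (t * fst e)\<^sup>2 + R * (t * snd e)\<^sup>2 = t\<^sup>2 * (P * (fst e)\<^sup>2 + R * (snd e)\<^sup>2)"
        by (simp add: algebra_simps power2_eq_square)
      then have "P * (t * fst e)\<^sup>2 + R * (t * snd e)\<^sup>2 = t\<^sup>2" using e(2) by simp
      then show ?thesis
        by (simp add: Z x e(1) \<psi>_def) (simp add: algebra_simps power2_eq_square)
    qed
  qed
  from qsic_sph_eq[OF this] have S: "qsic_sph A B = N ` (Z0 - {0})" .
  have NX: "N ` (Z0 - {0}) = N ` X \<union> uminus ` N ` X"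
  proof
    show "N ` (Z0 - {0}) \<subseteq> N ` X \<union> uminus ` N ` X"
    proof
      fix v assume "v \<in> N ` (Z0 - {0})"
      then obtain x where "x \<in> Z0" "x \<noteq> 0" "v = N x" by blast
      moreover from this obtain t y where "x = t *\<^sub>R y" "y \<in> X" by (auto simp: Z0_def)
      ultimately have "t \<noteq> 0" "y \<in> X" "v = N (t *\<^sub>R y)" by auto
      then show "v \<in> N ` X \<union> uminus ` N ` X" using N_scaleR_pos[of t y] N_scaleR_neg[of t y]
        by (cases "t > 0") auto
    qed
    have "x \<in> Z0 - {0}" "- x \<in> Z0 - {0}" if "x \<in> X" for x
    proof -
      have "(\<lambda>(t,x). t *\<^sub>R x) (1, x) \<in> Z0" "(\<lambda>(t,x). t *\<^sub>R x) (-1, x) \<in> Z0"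
        unfolding Z0_def using that by blast+
      then show "x \<in> Z0 - {0}" "- x \<in> Z0 - {0}" using X0[OF that] by auto
    qed
    then show "N ` X \<union> uminus ` N ` X \<subseteq> N ` (Z0 - {0})"
      by (auto simp flip: N_uminus)
  qed
  define p where "p = N e0"
  have S': "qsic_sph A B = K \<union> uminus ` K \<union> {p} \<union> {- p}"
    unfolding S NX by (auto simp: X_def K_def p_def)
  have cK: "continuous_on E (\<lambda>e. N (\<psi> e))"
    unfolding \<psi>_def by (intro continuous_on_N continuous_intros) (auto simp: vec_eq_iff_4)
  have K: "K = (\<lambda>e. N (\<psi> e)) ` E" by (auto simp: K_def)
  have conK: "connected K" "compact K" "K \<noteq> {}"
    unfolding K using E cK by (auto intro: connected_continuous_image compact_continuous_image)
  have conmK: "connected (uminus ` K)" "compact (uminus ` K)" "uminus ` K \<noteq> {}"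
    using conK by (auto intro!: connected_continuous_image compact_continuous_image continuous_intros)
  have pp: "p \<noteq> - p" unfolding p_def by (rule N_neq_uminus[OF e0])
  \<comment> \<open>The second coordinate of \<open>\<psi>\<close> is always 1, so a positive
    multiple of an antipode is impossible. Hence the oval lifts to two disjoint curves.\<close>
  have 1: "N (\<psi> e) \<noteq> - N (\<psi> f)" for e f
  proof
    assume "N (\<psi> e) = - N (\<psi> f)"
    then have "N (\<psi> e) = N (- \<psi> f)" by (simp add: N_uminus)
    then obtain l where l: "l > 0" "\<psi> e = l *\<^sub>R (- \<psi> f)"
      by (rule N_eqD) (use \<psi>0 in simp, use \<psi>0 in simp, erule (1) that)
    show False using l(1) arg_cong[OF l(2), of "\<lambda>v. v $ 1"] by (simp add: \<psi>_def)
  qed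
  have 2: "N (\<psi> e) \<noteq> p" "N (\<psi> e) \<noteq> - p" for e
  proof -
    show "N (\<psi> e) \<noteq> p"
    proof
      assume "N (\<psi> e) = p"
      then obtain l where l: "l > 0" "\<psi> e = l *\<^sub>R e0"
        unfolding p_def by (rule N_eqD) (use \<psi>0 e0 in simp, use \<psi>0 e0 in simp, erule (1) that)
      show False using arg_cong[OF l(2), of "\<lambda>v. v $ 1"] by (simp add: \<psi>_def e0_def)
    qed
    show "N (\<psi> e) \<noteq> - p"
    proof
      assume "N (\<psi> e) = - p"
      then have "N (\<psi> e) = N (- e0)" by (simp add: N_uminus p_def)
      then obtain l where l: "l > 0" "\<psi> e = l *\<^sub>R (- e0)"
      by (rule N_eqD) (use \<psi>0 e0 in simp, use \<psi>0 e0 in simp, erule (1) that)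
      show False using arg_cong[OF l(2), of "\<lambda>v. v $ 1"] by (simp add: \<psi>_def e0_def)
    qed
  qed
  have d1: "K \<inter> uminus ` K = {}" using 1 by (auto simp: K)
  have d2: "p \<notin> K" "- p \<notin> K" unfolding K using 2 by (metis imageE)+
  then have d3: "p \<notin> uminus ` K" "- p \<notin> uminus ` K" by (metis imageE minus_minus)+
  have "components (\<Union>{K, uminus ` K, {p}, {- p}}) = {K, uminus ` K, {p}, {- p}}"
  proof (rule components_Union_closed)
    show "pairwise disjnt {K, uminus ` K, {p}, {- p}}"
    proof -
      have "pairwise disjnt {K, K', {p}, {q}}"
        if "K \<inter> K' = {}" "p \<notin> K" "q \<notin> K" "p \<notin> K'" "q \<notin> K'" "p \<noteq> q" for K' q
        using that by (auto simp: pairwise_insert disjnt_def)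
      then show ?thesis using d1 d2 d3 pp by metis
    qed
    show "closed Y \<and> connected Y \<and> Y \<noteq> {}" if "Y \<in> {K, uminus ` K, {p}, {- p}}" for Y
      using that conK conmK by (auto intro: compact_imp_closed)
  qed simp
  moreover have "\<Union>{K, uminus ` K, {p}, {- p}} = qsic_sph A B" unfolding S' by blast
  ultimately have comp: "components (qsic_sph A B) = {K, uminus ` K, {p}, {- p}}" by simp
  let ?C = "K \<union> uminus ` K"
  have uu: "uminus ` uminus ` K = K" by (simp add: image_image)
  have pc: "proj_components A B = {?C, {p, - p}}"
    unfolding proj_components_def comp by (auto simp: uu)
  have ne: "?C \<noteq> {p, - p}" using d2 d3 by blast
  have clo: "closed_comp ?C"
    unfolding K_def by (rule closed_comp_N[of _ "vec4 0 1 0 0"]) (use E in \<open>auto simp: inner_vec4 \<psi>_def\<close>)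
  \<comment> \<open>The ends of an axis of the ellipse give two different points of
    \<open>K\<close>; in a set \<open>{q, - q}\<close> they would be antipodal, against
    \<open>1\<close>.\<close>
  have nq: "\<not> (\<exists>q. ?C = {q, - q})"
  proof
    assume "\<exists>q. ?C = {q, - q}"
    then obtain q where q: "?C = {q, - q}" by blast
    have "(1 / sqrt P, 0) \<in> E" "(- 1 / sqrt P, 0) \<in> E"
      using pos by (auto simp: E_def power_divide)
    let ?a = "N (\<psi> (1 / sqrt P, 0))" and ?b = "N (\<psi> (- 1 / sqrt P, 0))"
    have ab: "?a \<in> K" "?b \<in> K"
      using \<open>(1 / sqrt P, 0) \<in> E\<close> \<open>(- 1 / sqrt P, 0) \<in> E\<close> by (auto simp: K)
    have "?a \<noteq> ?b"
    proof
      assume "?a = ?b"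
      then obtain l where l: "l > 0" "\<psi> (1 / sqrt P, 0) = l *\<^sub>R \<psi> (- 1 / sqrt P, 0)"
        by (rule N_eqD) (use \<psi>0 in simp, use \<psi>0 in simp, erule (1) that)
      have "l = 1" using arg_cong[OF l(2), of "\<lambda>v. v $ 1"] by (simp add: \<psi>_def)
      then show False using pos arg_cong[OF l(2), of "\<lambda>v. v $ 2"] by (simp add: \<psi>_def field_simps)
    qed
    then have "?a = - ?b" using ab q by (metis UnI1 insertE minus_minus singletonD)
    then show False using 1 by blast
  qed
  have "lin (\<mu> \<cdot>\<^sub>m A + \<nu> \<cdot>\<^sub>m B) p = 0"
    using sing(2) by (simp add: p_def N_def e0_def linear_cmul[OF linear_lin])
  then have "qsic_sing A B p" using A B sing(1) S' by (intro qsic_singI) auto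
  moreover have "closed (K \<union> uminus ` K \<union> {- p})"
    using conK(2) conmK(2) by (intro closed_Un compact_imp_closed) simp_all
  moreover have "qsic_sph A B \<subseteq> insert p (K \<union> uminus ` K \<union> {- p})"
    and "p \<notin> K \<union> uminus ` K \<union> {- p}" using S' d2 d3 pp by blast+
  ultimately have "acnode A B p" by (intro acnodeI)
  then show ?thesis using pc ne clo nq by (intro exI[of _ ?C] exI[of _ p] conjI)
qed

text \<open>In the chart \<open>x $ 2 = 1\<close> the curve is \<open>((1 - v\<^sup>2) / (2 * y), y, 1, v)\<close> over the ellipse
  \<open>y\<^sup>2 + R * v\<^sup>2 = P\<close>. Multiplying by \<open>2 * y\<close> extends this over the two points with \<open>y = 0\<close>, both of
  which map to the node.\<close>

lemma (in frame) figure_eight: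
  assumes A: "A \<in> carrier_mat 4 4" and B: "B \<in> carrier_mat 4 4"
    and Z: "\<And>x. (qf A (lin Q x) = 0 \<and> qf B (lin Q x) = 0) \<longleftrightarrow>
        2 * x $ 0 * x $ 1 = (x $ 2)\<^sup>2 - (x $ 3)\<^sup>2 \<and> (x $ 1)\<^sup>2 = P * (x $ 2)\<^sup>2 - R * (x $ 3)\<^sup>2"
    and pos: "P > 0" "R > 0" "P \<noteq> R"
    and sing: "(\<mu>, \<nu>) \<noteq> (0, 0)" "lin (\<mu> \<cdot>\<^sub>m A + \<nu> \<cdot>\<^sub>m B) (lin Q (vec4 1 0 0 0)) = 0"
  shows "\<exists>C. proj_components A B = {C} \<and> closed_comp C \<and> (\<exists>p\<in>C. crunode A B p)"
proof -
  define e0 where "e0 = vec4 1 0 0 0"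
  have e0: "e0 \<noteq> 0" by (simp add: e0_def vec_eq_iff_4)
  define E where "E = {e. (1 / P) * (fst e)\<^sup>2 + (R / P) * (snd e)\<^sup>2 = 1}"
  have E: "connected E" "compact E" "E \<noteq> {}"
    unfolding E_def using pos by (intro ellipse_connected_compact; simp)+
  have Eiff: "e \<in> E \<longleftrightarrow> (fst e)\<^sup>2 + R * (snd e)\<^sup>2 = P" for e
    using pos by (auto simp: E_def field_simps)
  define \<psi> where "\<psi> e = vec4 (1 - (snd e)\<^sup>2) (2 * (fst e)\<^sup>2) (2 * fst e) (2 * fst e * snd e)" for e
  \<comment> \<open>At the two points of \<open>E\<close> with first coordinate 0 the square of the
    second is \<open>P / R\<close>, so \<open>\<psi>\<close> takes the value
    \<open>D *\<^sub>R e0\<close> at both. It is nonzero exactly because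
    \<open>P \<noteq> R\<close>.\<close>
  define D where "D = 1 - P / R"
  have D0: "D \<noteq> 0" using pos by (simp add: D_def field_simps)
  have ED: "1 - (snd e)\<^sup>2 = D" if "e \<in> E" "fst e = 0" for e
    using that pos by (simp add: Eiff D_def field_simps)
  have \<psi>0: "\<psi> e \<noteq> 0" if "e \<in> E" for e
    using ED[OF that] D0 by (cases "fst e = 0") (auto simp: \<psi>_def vec_eq_iff_4)
  have \<psi>e0: "\<psi> e = D *\<^sub>R e0" if "e \<in> E" "fst e = 0" for e
    using ED[OF that] that by (simp add: \<psi>_def e0_def vec_eq_iff_4)
  define v0 where "v0 = sqrt (P / R)"
  have v0: "v0 > 0" "(0, v0) \<in> E" using pos by (simp_all add: v0_def Eiff)
  define K where "K = N ` \<psi> ` E"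
  define Z0 where "Z0 = (\<lambda>(t,x). t *\<^sub>R x) ` (UNIV \<times> \<psi> ` E)"
  have "(qf A (lin Q x) = 0 \<and> qf B (lin Q x) = 0) \<longleftrightarrow> x \<in> Z0" for x
  proof
    assume "qf A (lin Q x) = 0 \<and> qf B (lin Q x) = 0"
    then have 1: "2 * x $ 0 * x $ 1 = (x $ 2)\<^sup>2 - (x $ 3)\<^sup>2"
      and 2: "(x $ 1)\<^sup>2 = P * (x $ 2)\<^sup>2 - R * (x $ 3)\<^sup>2" using Z by auto
    show "x \<in> Z0"
    proof (cases "x $ 1 = 0")
      case True
      \<comment> \<open>With \<open>x $ 1 = 0\<close> both equations are linear in the squares of
        \<open>x $ 2\<close> and \<open>x $ 3\<close>, with determinant \<open>P - R\<close>, so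
        only the node remains.\<close>
      have 3: "(x $ 2)\<^sup>2 = (x $ 3)\<^sup>2" using 1 True by simp
      then have "(P - R) * (x $ 3)\<^sup>2 = 0" using 2 True by (auto simp: algebra_simps)
      then have "x $ 3 = 0" "x $ 2 = 0" using 3 pos(3) by auto
      then have "x = (\<lambda>(t,x). t *\<^sub>R x) (x $ 0 / D, \<psi> (0, v0))"
        using True D0 \<psi>e0[OF v0(2)] by (simp add: vec_eq_iff_4 e0_def)
      then show ?thesis unfolding Z0_def using v0(2) by blast
    next
      case False
      have x2: "x $ 2 \<noteq> 0"
      proof
        assume "x $ 2 = 0"
        then have "(x $ 1)\<^sup>2 = - (R * (x $ 3)\<^sup>2)" using 2 by simp
        moreover have "(x $ 1)\<^sup>2 > 0" "R * (x $ 3)\<^sup>2 \<ge> 0" using False pos by auto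
        ultimately show False by linarith
      qed
      define e where "e = (x $ 1 / x $ 2, x $ 3 / x $ 2)"
      have "(fst e)\<^sup>2 + R * (snd e)\<^sup>2 = ((x $ 1)\<^sup>2 + R * (x $ 3)\<^sup>2) / (x $ 2)\<^sup>2"
        by (simp add: e_def power_divide add_divide_distrib)
      then have eE: "e \<in> E" unfolding Eiff 2 using x2 by simp
      \<comment> \<open>Found from the third coordinate: \<open>t * (2 * x $ 1 / x $ 2)\<close> has
        to equal \<open>x $ 2\<close>.\<close>
      define t where "t = (x $ 2)\<^sup>2 / (2 * x $ 1)"
      have "1 - (snd e)\<^sup>2 = ((x $ 2)\<^sup>2 - (x $ 3)\<^sup>2) / (x $ 2)\<^sup>2"
        using x2 by (simp add: e_def field_simps)
      then have "t * (1 - (snd e)\<^sup>2) = ((x $ 2)\<^sup>2 - (x $ 3)\<^sup>2) / (2 * x $ 1)"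
        using x2 by (simp add: t_def)
      also have "\<dots> = x $ 0" using False by (simp add: 1[symmetric])
      finally have "x = (\<lambda>(t,x). t *\<^sub>R x) (t, \<psi> e)"
        using False x2 by (simp add: vec_eq_iff_4 \<psi>_def) (simp add: t_def e_def power2_eq_square)
      then show ?thesis unfolding Z0_def using eE by blast
    qed
  next
    assume "x \<in> Z0"
    then obtain t e where x: "x = t *\<^sub>R \<psi> e" and e: "e \<in> E" by (auto simp: Z0_def)
    have P: "P = (fst e)\<^sup>2 + R * (snd e)\<^sup>2" using e by (simp add: Eiff)
    show "qf A (lin Q x) = 0 \<and> qf B (lin Q x) = 0"
      unfolding Z x by (subst P) (simp add: \<psi>_def algebra_simps power2_eq_square)
  qed
  from qsic_sph_eq[OF this] have S: "qsic_sph A B = N ` (Z0 - {0})" .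
  have NX: "N ` (Z0 - {0}) = K \<union> uminus ` K"
  proof
    show "N ` (Z0 - {0}) \<subseteq> K \<union> uminus ` K"
    proof
      fix v assume "v \<in> N ` (Z0 - {0})"
      then obtain x where "x \<in> Z0" "x \<noteq> 0" "v = N x" by blast
      moreover from this obtain t y where "x = t *\<^sub>R y" "y \<in> \<psi> ` E" by (auto simp: Z0_def)
      ultimately have "t \<noteq> 0" "y \<in> \<psi> ` E" "v = N (t *\<^sub>R y)" by auto
      then show "v \<in> K \<union> uminus ` K" using N_scaleR_pos[of t y] N_scaleR_neg[of t y]
        unfolding K_def by (cases "t > 0") auto
    qed
    have "x \<in> Z0 - {0}" "- x \<in> Z0 - {0}" if "x \<in> \<psi> ` E" for x
    proof -
      have "(\<lambda>(t,x). t *\<^sub>R x) (1, x) \<in> Z0" "(\<lambda>(t,x). t *\<^sub>R x) (-1, x) \<in> Z0"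
        unfolding Z0_def using that by blast+
      then show "x \<in> Z0 - {0}" "- x \<in> Z0 - {0}" using \<psi>0 that by auto
    qed
    then show "K \<union> uminus ` K \<subseteq> N ` (Z0 - {0})"
      unfolding K_def by (auto simp flip: N_uminus)
  qed
  have S': "qsic_sph A B = K \<union> uminus ` K" unfolding S NX ..
  have cK: "continuous_on F (\<lambda>e. N (\<psi> e))" if "F \<subseteq> E" for F
    using \<psi>0 that by (intro continuous_on_N) (auto simp: \<psi>_def intro!: continuous_intros)
  have K: "K = (\<lambda>e. N (\<psi> e)) ` E" by (auto simp: K_def)
  have conK: "connected K" "compact K" "K \<noteq> {}"
    unfolding K using E cK[of E] by (auto intro: connected_continuous_image compact_continuous_image)
  have conmK: "connected (uminus ` K)" "compact (uminus ` K)" "uminus ` K \<noteq> {}"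
    using conK by (auto intro!: connected_continuous_image compact_continuous_image continuous_intros)
  \<comment> \<open>The second coordinate of \<open>\<psi>\<close> is twice a square, so antipodal
    images need first parameter 0 at both points. There both values are
    \<open>D *\<^sub>R e0\<close>, which is no negative multiple of itself.\<close>
  have 1: "N (\<psi> e) \<noteq> - N (\<psi> f)" if ef: "e \<in> E" "f \<in> E" for e f
  proof
    assume "N (\<psi> e) = - N (\<psi> f)"
    then have "N (\<psi> e) = N (- \<psi> f)" by (simp add: N_uminus)
    then obtain l where l: "l > 0" "\<psi> e = l *\<^sub>R (- \<psi> f)"
      by (rule N_eqD) (use \<psi>0 ef in simp, use \<psi>0 ef in simp, erule (1) that)
    have "(fst e)\<^sup>2 = - (l * (fst f)\<^sup>2)"
      using arg_cong[OF l(2), of "\<lambda>v. v $ 1"]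
      by (simp only: \<psi>_def vec4_nth vector_scaleR_component vector_uminus_component real_scaleR_def)
    moreover have "(fst e)\<^sup>2 \<ge> 0" "l * (fst f)\<^sup>2 \<ge> 0" using l by auto
    ultimately have "(fst e)\<^sup>2 = 0" "l * (fst f)\<^sup>2 = 0" by linarith+
    then have z: "fst e = 0" "fst f = 0" using l(1) by auto
    have "D *\<^sub>R e0 = l *\<^sub>R (- (D *\<^sub>R e0))"
      using l(2) unfolding \<psi>e0[OF ef(1) z(1)] \<psi>e0[OF ef(2) z(2)] .
    then have "D = - (l * D)" by (simp add: e0_def vec_eq_iff_4)
    then have "D * (1 + l) = 0" by (simp add: algebra_simps)
    then show False using D0 l by auto
  qed
  \<comment> \<open>The parametrization is injective apart from gluing the two points of
    \<open>E\<close> over the node, which makes \<open>K\<close> a figure eight.\<close>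
  have 2: "fst e = 0 \<and> fst f = 0 \<or> e = f" if eq: "N (\<psi> e) = N (\<psi> f)" and ef: "e \<in> E" "f \<in> E" for e f
  proof -
    obtain l where l: "l > 0" "\<psi> e = l *\<^sub>R \<psi> f"
      using eq by (rule N_eqD) (use \<psi>0 ef in simp, use \<psi>0 ef in simp, erule (1) that)
    have a: "fst e = l * fst f" using arg_cong[OF l(2), of "\<lambda>v. v $ 2"]
      by (simp only: \<psi>_def vec4_nth vector_scaleR_component vector_uminus_component real_scaleR_def)
    have b: "(fst e)\<^sup>2 = l * (fst f)\<^sup>2" using arg_cong[OF l(2), of "\<lambda>v. v $ 1"]
      by (simp only: \<psi>_def vec4_nth vector_scaleR_component vector_uminus_component real_scaleR_def)
    have c: "2 * fst e * snd e = l * (2 * fst f * snd f)" using arg_cong[OF l(2), of "\<lambda>v. v $ 3"]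
      by (simp only: \<psi>_def vec4_nth vector_scaleR_component vector_uminus_component real_scaleR_def)
    show ?thesis
    proof (cases "fst f = 0")
      case True
      then show ?thesis using a by simp
    next
      case False
      have "l * l * (fst f)\<^sup>2 = l * (fst f)\<^sup>2" using b unfolding a by (simp add: power2_eq_square mult_ac)
      then have "l = 1" using False l by simp
      then show ?thesis using a c False by (simp add: prod_eq_iff)
    qed
  qed
  have d1: "K \<inter> uminus ` K = {}" using 1 by (auto simp: K)
  have "components (\<Union>{K, uminus ` K}) = {K, uminus ` K}"
  proof (rule components_Union_closed)
    show "pairwise disjnt {K, uminus ` K}"
      unfolding pairwise_def disjnt_def using d1 by blast
    show "closed Y \<and> connected Y \<and> Y \<noteq> {}" if "Y \<in> {K, uminus ` K}" for Y
      using that conK conmK by (auto intro: compact_imp_closed)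
  qed simp
  then have comp: "components (qsic_sph A B) = {K, uminus ` K}" by (simp add: S')
  let ?C = "K \<union> uminus ` K"
  have uu: "uminus ` uminus ` K = K" by (simp add: image_image)
  have pc: "proj_components A B = {?C}"
    unfolding proj_components_def comp by (auto simp: uu)
  \<comment> \<open>The chosen linear form is constant on the parametrized curve: on
    \<open>\<psi> e\<close> it equals
    \<open>1 - ((fst e)\<^sup>2 + R * (snd e)\<^sup>2) / R\<close>, which is \<open>D\<close> by the
    equation of the ellipse.\<close>
  have clo: "closed_comp ?C"
    unfolding K_def
  proof (rule closed_comp_N[of _ "vec4 1 (- 1 / (2 * R)) 0 0"])
    fix x assume "x \<in> \<psi> ` E"
    then obtain e where e: "e \<in> E" "x = \<psi> e" by blast
    have "vec4 1 (- 1 / (2 * R)) 0 0 \<bullet> x = 1 - ((fst e)\<^sup>2 + R * (snd e)\<^sup>2) / R"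
      using pos by (simp add: inner_vec4 e(2) \<psi>_def field_simps)
    also have "\<dots> = D" using e(1) by (simp add: Eiff D_def)
    finally show "vec4 1 (- 1 / (2 * R)) 0 0 \<bullet> x \<noteq> 0" using D0 by simp
  qed (use E in auto)
  define p where "p = N (\<psi> (0, v0))"
  have pD: "p = N (D *\<^sub>R e0)" unfolding p_def using \<psi>e0[OF v0(2)] by simp
  have pe: "N (\<psi> e) = p" if "e \<in> E" "fst e = 0" for e using \<psi>e0[OF that] pD by simp
  have pK: "p \<in> K" unfolding K p_def using v0 by blast
  \<comment> \<open>Half of the semi-axis of the ellipse in the first direction: for
    \<open>\<bar>t\<bar> \<le> 1\<close> the radicand of \<open>r t\<close> stays positive, so the
    arcs through \<open>(0, v0)\<close> and \<open>(0, - v0)\<close> do not touch. They become the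
    two branches \<open>g1\<close> and \<open>g2\<close>.\<close>
  define c where "c = sqrt P / 2"
  have c: "c > 0" "c\<^sup>2 = P / 4" using pos by (auto simp: c_def power_divide)
  define r where "r t = sqrt ((P - (c * t)\<^sup>2) / R)" for t
  have r: "r t > 0" "(c * t, r t) \<in> E" "(c * t, - r t) \<in> E" if "t \<in> {-1..1}" for t
  proof -
    have "t\<^sup>2 \<le> 1" using that by (auto simp: abs_square_le_1 abs_le_iff)
    then have "(c * t)\<^sup>2 \<le> P / 4 * 1" unfolding power_mult_distrib c using pos by (intro mult_left_mono) auto
    then have "P - (c * t)\<^sup>2 > 0" using pos by simp
    then have q: "(P - (c * t)\<^sup>2) / R > 0" using pos by simp
    then show "r t > 0" by (simp add: r_def)
    have "(r t)\<^sup>2 = (P - (c * t)\<^sup>2) / R" unfolding r_def using q by simp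
    then show "(c * t, r t) \<in> E" "(c * t, - r t) \<in> E" using pos by (simp_all add: Eiff)
  qed
  define g1 where "g1 t = N (\<psi> (c * t, r t))" for t
  define g2 where "g2 t = N (\<psi> (c * t, - r t))" for t
  have co: "continuous_on {-1..1} (\<lambda>t. \<psi> (c * t, r t))" "continuous_on {-1..1} (\<lambda>t. \<psi> (c * t, - r t))"
    unfolding \<psi>_def r_def fst_conv snd_conv by (intro continuous_intros; use pos in simp)+
  have cont1: "continuous_on {-1..1} g1"
    unfolding g1_def by (rule continuous_on_N[OF co(1)]) (rule \<psi>0[OF r(2)])
  have cont2: "continuous_on {-1..1} g2"
    unfolding g2_def by (rule continuous_on_N[OF co(2)]) (rule \<psi>0[OF r(3)])
  have inj1: "inj_on g1 {-1..1}"
  proof (rule inj_onI)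
    fix s t :: real assume st: "s \<in> {-1..1}" "t \<in> {-1..1}" "g1 s = g1 t"
    from 2[OF st(3)[unfolded g1_def] r(2)[OF st(1)] r(2)[OF st(2)]] c(1) show "s = t" by auto
  qed
  have inj2: "inj_on g2 {-1..1}"
  proof (rule inj_onI)
    fix s t :: real assume st: "s \<in> {-1..1}" "t \<in> {-1..1}" "g2 s = g2 t"
    from 2[OF st(3)[unfolded g2_def] r(3)[OF st(1)] r(3)[OF st(2)]] c(1) show "s = t" by auto
  qed
  have g0: "g1 0 = p" "g2 0 = p"
    using pe[OF r(2), of 0] pe[OF r(3), of 0] by (simp_all add: g1_def g2_def)
  have int: "g1 ` {-1..1} \<inter> g2 ` {-1..1} = {p}"
  proof
    show "{p} \<subseteq> g1 ` {-1..1} \<inter> g2 ` {-1..1}"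
      using g0 by (auto intro: rev_image_eqI[of "0::real"])
    show "g1 ` {-1..1} \<inter> g2 ` {-1..1} \<subseteq> {p}"
    proof
      fix x assume "x \<in> g1 ` {-1..1} \<inter> g2 ` {-1..1}"
      then obtain s t where st: "s \<in> {-1..1}" "t \<in> {-1..1}" "x = g1 s" "g1 s = g2 t" by auto
      \<comment> \<open>The ellipse points have second coordinates \<open>r s > 0\<close> and
        \<open>- r t < 0\<close>, so they differ, and \<open>2\<close> leaves only the node.\<close>
      from 2[OF st(4)[unfolded g1_def g2_def] r(2)[OF st(1)] r(3)[OF st(2)]]
      have "c * s = 0" using r(1)[OF st(1)] r(1)[OF st(2)] by auto
      then show "x \<in> {p}" using st(3) g0 c by simp
    qed
  qed
  have sub: "g1 ` {-1..1} \<union> g2 ` {-1..1} \<subseteq> K" unfolding g1_def g2_def K using r by auto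
  \<comment> \<open>The part of the ellipse not covered by the two arcs. It is compact and stays
    away from first coordinate 0, so its image is closed and misses \<open>p\<close>; together with
    the antipodal copy of \<open>K\<close> it bounds the neighbourhood of the node.\<close>
  define F where "F = E \<inter> {e. c \<le> \<bar>fst e\<bar>}"
  have F: "compact F" unfolding F_def
    by (intro compact_Int_closed E closed_Collect_le continuous_intros)
  let ?R = "(\<lambda>e. N (\<psi> e)) ` F \<union> uminus ` K"
  have clR: "closed ?R"
    using compact_continuous_image[OF cK F] conmK by (auto simp: F_def intro!: closed_Un compact_imp_closed)
  have pR: "p \<notin> ?R"
  proof
    assume "p \<in> ?R"
    then consider e where "e \<in> F" "p = N (\<psi> e)" | "p \<in> uminus ` K" by blast
    then show False
    proof cases
      case 1
      from 2[OF 1(2)[unfolded p_def, symmetric], of] 1(1) v0 c show False by (auto simp: F_def)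
    next
      case 2
      then show False using d1 pK by blast
    qed
  qed
  have cover: "qsic_sph A B \<subseteq> g1 ` {-1..1} \<union> g2 ` {-1..1} \<union> ?R"
  proof
    fix x assume "x \<in> qsic_sph A B"
    then consider "x \<in> K" | "x \<in> uminus ` K" unfolding S' by blast
    then show "x \<in> g1 ` {-1..1} \<union> g2 ` {-1..1} \<union> ?R"
    proof cases
      case 1
      then obtain e where e: "e \<in> E" "x = N (\<psi> e)" by (auto simp: K)
      show ?thesis
      proof (cases "c \<le> \<bar>fst e\<bar>")
        case True
        then show ?thesis using e by (auto simp: F_def)
      next
        case False
        define t where "t = fst e / c"
        have t: "t \<in> {-1..1}" using False c by (auto simp: t_def field_simps abs_if split: if_splits)
        have ct: "c * t = fst e" using c by (simp add: t_def)
        have "(snd e)\<^sup>2 = (P - (c * t)\<^sup>2) / R" using e(1) pos by (simp add: Eiff ct field_simps)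
        then have "r t = \<bar>snd e\<bar>" by (simp add: r_def flip: real_sqrt_abs)
        then have "e = (c * t, r t) \<or> e = (c * t, - r t)" by (auto simp: ct prod_eq_iff)
        then have "x = g1 t \<or> x = g2 t" unfolding g1_def g2_def e(2) by auto
        then show ?thesis using t by blast
      qed
    qed blast
  qed
  obtain \<epsilon> where \<epsilon>: "\<epsilon> > 0" "ball p \<epsilon> \<subseteq> - ?R"
    using clR pR open_contains_ball[of "- ?R"] by (metis ComplI open_Compl)
  have "lin (\<mu> \<cdot>\<^sub>m A + \<nu> \<cdot>\<^sub>m B) p = 0"
    using sing(2) by (simp add: pD N_def e0_def linear_cmul[OF linear_lin])
  then have sp: "qsic_sing A B p" using A B sing(1) S' pK by (intro qsic_singI) auto
  have near: "ball p \<epsilon> \<inter> qsic_sph A B \<subseteq> g1 ` {-1..1} \<union> g2 ` {-1..1}"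
    using cover \<epsilon>(2) by blast
  have sub': "g1 ` {-1..1} \<union> g2 ` {-1..1} \<subseteq> qsic_sph A B" using sub S' by blast
  have "crunode A B p"
    unfolding crunode_def
    by (intro conjI exI[of _ \<epsilon>] exI[of _ g1] exI[of _ g2]) (fact sp \<epsilon>(1) cont1 cont2 inj1 inj2 g0 int sub' near)+
  then have "\<exists>p\<in>?C. crunode A B p" using pK by (intro bexI[of _ p]) simp_all
  then show ?thesis using pc clo by (intro exI[of _ ?C] conjI)
qed

section \<open>Reduction to canonical coordinates\<close>

text \<open>Subtracting \<open>a\<close> times the first new form from the second removes the mixed
  term. The resulting member \<open>M\<close> kills the first basis vector, which accounts both for
  the second equation and for the singular point; \<open>\<mu>\<close> and \<open>\<nu>\<close> are
  its coefficients in the original basis.\<close>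

lemma canon211_frame:
  assumes A: "A \<in> carrier_mat 4 4" and B: "B \<in> carrier_mat 4 4"
    and D: "\<alpha> * \<delta> - \<beta> * \<gamma> \<noteq> 0"
    and can: "canon211 (\<alpha> \<cdot>\<^sub>m A + \<beta> \<cdot>\<^sub>m B) (\<gamma> \<cdot>\<^sub>m A + \<delta> \<cdot>\<^sub>m B) a b c e1 e2 e3"
  shows "\<exists>Q \<mu> \<nu>. frame Q \<and>
     (\<forall>x. (qf A (lin Q x) = 0 \<and> qf B (lin Q x) = 0) \<longleftrightarrow>
          2 * e1 * x $ 0 * x $ 1 + e2 * (x $ 2)\<^sup>2 + e3 * (x $ 3)\<^sup>2 = 0 \<and>
          e1 * (x $ 1)\<^sup>2 + e2 * (b - a) * (x $ 2)\<^sup>2 + e3 * (c - a) * (x $ 3)\<^sup>2 = 0) \<and>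
     (\<mu>, \<nu>) \<noteq> (0, 0) \<and> lin (\<mu> \<cdot>\<^sub>m A + \<nu> \<cdot>\<^sub>m B) (lin Q (vec4 1 0 0 0)) = 0"
proof -
  let ?A = "\<alpha> \<cdot>\<^sub>m A + \<beta> \<cdot>\<^sub>m B" and ?B = "\<gamma> \<cdot>\<^sub>m A + \<delta> \<cdot>\<^sub>m B"
  have cA: "?A \<in> carrier_mat 4 4" and cB: "?B \<in> carrier_mat 4 4" using A B by auto
  obtain Q where Q: "Q \<in> carrier_mat 4 4" "Determinant.det Q \<noteq> 0" "cong_mat Q ?A = blk e1 0 e2 e3"
       "cong_mat Q ?B = blk (e1 * a) e1 (e2 * b) (e3 * c)"
    using can unfolding canon211_iff by blast
  define \<mu> where "\<mu> = \<gamma> - a * \<alpha>"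
  define \<nu> where "\<nu> = \<delta> - a * \<beta>"
  define M where "M = \<mu> \<cdot>\<^sub>m A + \<nu> \<cdot>\<^sub>m B"
  have cM: "M \<in> carrier_mat 4 4" using A B by (simp add: M_def)
  have Meq: "M = (- a) \<cdot>\<^sub>m ?A + 1 \<cdot>\<^sub>m ?B"
    unfolding M_def using A B by (intro eq_matI) (auto simp: \<mu>_def \<nu>_def algebra_simps)
  have QM: "cong_mat Q M = blk 0 e1 (e2 * (b - a)) (e3 * (c - a))"
    unfolding Meq cong_mat_lincomb[OF Q(1) cA cB] Q(3,4) blk_lincomb by (simp add: algebra_simps)
  have qM: "qf M y = - a * qf ?A y + qf ?B y" for y
    unfolding Meq using qf_lincomb[OF cA cB, of "- a" 1] by simp
  \<comment> \<open>The base change is invertible, so Cramer's rule recovers both original forms;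
    adding a multiple of \<open>?A\<close> to \<open>?B\<close> does not change the common
    zeros.\<close>
  have equiv: "(qf A y = 0 \<and> qf B y = 0) \<longleftrightarrow> (qf ?A y = 0 \<and> qf M y = 0)" for y
  proof -
    have "\<delta> * qf ?A y - \<beta> * qf ?B y = (\<alpha> * \<delta> - \<beta> * \<gamma>) * qf A y"
      "\<alpha> * qf ?B y - \<gamma> * qf ?A y = (\<alpha> * \<delta> - \<beta> * \<gamma>) * qf B y"
      using A B by (simp_all add: qf_lincomb algebra_simps)
    moreover have "qf ?A y = \<alpha> * qf A y + \<beta> * qf B y" "qf ?B y = \<gamma> * qf A y + \<delta> * qf B y"
      using A B by (simp_all add: qf_lincomb)
    ultimately show ?thesis using D qM[of y] by auto
  qed
  have fr: "frame Q" using Q by unfold_locales auto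
  have "\<mu> \<noteq> 0 \<or> \<nu> \<noteq> 0"
  proof (rule ccontr)
    assume "\<not> (\<mu> \<noteq> 0 \<or> \<nu> \<noteq> 0)"
    then have "\<gamma> = a * \<alpha>" "\<delta> = a * \<beta>" by (auto simp: \<mu>_def \<nu>_def)
    then show False using D by simp
  qed
  then have nz: "(\<mu>, \<nu>) \<noteq> (0, 0)" by simp
  have Z: "(qf A (lin Q x) = 0 \<and> qf B (lin Q x) = 0) \<longleftrightarrow>
          2 * e1 * x $ 0 * x $ 1 + e2 * (x $ 2)\<^sup>2 + e3 * (x $ 3)\<^sup>2 = 0 \<and>
          e1 * (x $ 1)\<^sup>2 + e2 * (b - a) * (x $ 2)\<^sup>2 + e3 * (c - a) * (x $ 3)\<^sup>2 = 0" for x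
    unfolding equiv qf_cong_mat[OF Q(1) cA, symmetric] qf_cong_mat[OF Q(1) cM, symmetric] Q(3) QM qf_blk
    by simp
  have "lin M (lin Q (vec4 1 0 0 0)) = 0"
  proof -
    have QtM: "transpose_mat Q * M \<in> carrier_mat 4 4"
      using Q cM by (intro mult_carrier_mat[of _ 4 4]) auto
    have "lin (cong_mat Q M) (vec4 1 0 0 0) = 0"
      unfolding QM by (simp add: vec_eq_iff_4 lin_def sum_UNIV_4 blk_def idx4_def)
    then have "lin (transpose_mat Q) (lin M (lin Q (vec4 1 0 0 0))) = lin (transpose_mat Q) 0"
      using Q cM QtM linear_0[OF linear_lin] by (simp add: cong_mat_def lin_mult)
    then show ?thesis
      using inj_lin[of "transpose_mat Q"] Q by (simp add: Determinant.det_transpose inj_eq)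
  qed
  then show ?thesis using fr Z nz unfolding M_def
    by (intro exI[of _ Q] exI[of _ \<mu>] exI[of _ \<nu>] conjI allI)
qed

lemma iseq_equivD:
  assumes A: "A \<in> carrier_mat 4 4" "transpose_mat A = A" and B: "B \<in> carrier_mat 4 4" "transpose_mat B = B"
    and iseq: "iseq_equiv A B (n0, [([Wr s, Wr s], n1), ([Bar], n2), ([Bar], n3)])"
  obtains \<alpha> \<beta> \<gamma> \<delta> a b c e2 e3 where "\<alpha> * \<delta> - \<beta> * \<gamma> \<noteq> 0" "a < b" "b < c" "e2 \<in> {-1,1}" "e3 \<in> {-1,1}"
    "canon211 (\<alpha> \<cdot>\<^sub>m A + \<beta> \<cdot>\<^sub>m B) (\<gamma> \<cdot>\<^sub>m A + \<delta> \<cdot>\<^sub>m B) a b c (if s then 1 else -1) e2 e3"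
    "n2 = 1 + of_bool (e2 = 1) + of_bool (e3 = -1)" "n3 = 1 + of_bool (e2 = 1) + of_bool (e3 = 1)"
proof -
  obtain \<alpha> \<beta> \<gamma> \<delta> where D: "\<alpha> * \<delta> - \<beta> * \<gamma> \<noteq> 0"
    and has: "has_iseq (\<alpha> \<cdot>\<^sub>m A + \<beta> \<cdot>\<^sub>m B) (\<gamma> \<cdot>\<^sub>m A + \<delta> \<cdot>\<^sub>m B) (n0, [([Wr s, Wr s], n1), ([Bar], n2), ([Bar], n3)])"
    using iseq unfolding iseq_equiv_def by blast
  have c: "\<alpha> \<cdot>\<^sub>m A + \<beta> \<cdot>\<^sub>m B \<in> carrier_mat 4 4" "\<gamma> \<cdot>\<^sub>m A + \<delta> \<cdot>\<^sub>m B \<in> carrier_mat 4 4" using A B by auto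
  note t = transpose_lincomb[OF A(1) B(1) A(2) B(2)]
  obtain a b c e2 e3 where "a < b" "b < c" "e2 \<in> {-1,1}" "e3 \<in> {-1,1}"
    "canon211 (\<alpha> \<cdot>\<^sub>m A + \<beta> \<cdot>\<^sub>m B) (\<gamma> \<cdot>\<^sub>m A + \<delta> \<cdot>\<^sub>m B) a b c (if s then 1 else -1) e2 e3"
    "n2 = 1 + of_bool (e2 = 1) + of_bool (e3 = -1)" "n3 = 1 + of_bool (e2 = 1) + of_bool (e3 = 1)"
    using has_iseq_D[OF c(1) t c(2) t has] by (elim exE conjE)
  then show thesis by (rule that[OF D])
qed

theorem theorem7:
  fixes A B :: "real mat"
  assumes "A \<in> carrier_mat 4 4" and "B \<in> carrier_mat 4 4"
    and "transpose_mat A = A" and "transpose_mat B = B"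
    and "pencil_poly A B \<noteq> 0"
    and "\<exists>a b c. distinct [a, b, c] \<and>
           order a (pencil_poly A B) = 2 \<and> order b (pencil_poly A B) = 1 \<and>
           order c (pencil_poly A B) = 1 \<and>
           (\<forall>x. poly (pencil_poly A B) x = 0 \<longrightarrow> x \<in> {a, b, c}) \<and>
           (\<exists>Ai. Ai \<in> carrier_mat 4 4 \<and> Ai * A = 1\<^sub>m 4 \<and>
                 jordan_nf (Ai * B) [(2, a), (1, b), (1, c)])"
  shows "(iseq_equiv A B S_22m \<or> iseq_equiv A B S_22p \<or>
          iseq_equiv A B S_11m \<or> iseq_equiv A B S_11p)
     \<and> ((iseq_equiv A B S_22m \<or> iseq_equiv A B S_22p) \<longrightarrow>
          (\<exists>C. proj_components A B = {C} \<and> closed_comp C \<and> (\<exists>p\<in>C. crunode A B p)))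
     \<and> (iseq_equiv A B S_11m \<longrightarrow>
          (\<exists>C p. proj_components A B = {C, {p, -p}} \<and> C \<noteq> {p, -p} \<and>
                 closed_comp C \<and> \<not> (\<exists>q. C = {q, -q}) \<and> acnode A B p))
     \<and> (iseq_equiv A B S_11p \<longrightarrow>
          (\<exists>p. qsic_sph A B = {p, -p} \<and> acnode A B p))"
proof (intro conjI impI)
  note A = assms(1,3) and B = assms(2,4)
  obtain a b c Ai where d: "distinct [a, b, c]" and Ai: "Ai \<in> carrier_mat 4 4" "Ai * A = 1\<^sub>m 4"
      "jordan_nf (Ai * B) [(2, a), (1, b), (1, c)]"
    using assms(6) by blast
  obtain e1 e2 e3 where "e1 \<in> {-1,1}" "e2 \<in> {-1,1}" "e3 \<in> {-1,1}" "canon211 A B a b c e1 e2 e3"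
    using canon211_exists[OF A(1) B(1) A(2) B(2) d Ai] by blast
  then show "iseq_equiv A B S_22m \<or> iseq_equiv A B S_22p \<or> iseq_equiv A B S_11m \<or> iseq_equiv A B S_11p"
    using iseq_equiv_cases[OF A B _ _ _ _ d] by blast
  show "\<exists>C. proj_components A B = {C} \<and> closed_comp C \<and> (\<exists>p\<in>C. crunode A B p)"
    if S22: "iseq_equiv A B S_22m \<or> iseq_equiv A B S_22p"
  proof -
    obtain s where "iseq_equiv A B (2, [([Wr s, Wr s], 2), ([Bar], 3), ([Bar], 2)])"
      using S22 unfolding S_22m_def S_22p_def by blast
    then obtain \<alpha> \<beta> \<gamma> \<delta> a b c e2 e3 where D: "\<alpha> * \<delta> - \<beta> * \<gamma> \<noteq> 0" and abc: "a < b" "b < c"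
      and can: "canon211 (\<alpha> \<cdot>\<^sub>m A + \<beta> \<cdot>\<^sub>m B) (\<gamma> \<cdot>\<^sub>m A + \<delta> \<cdot>\<^sub>m B) a b c (if s then 1 else -1) e2 e3"
      and n: "3 = 1 + of_bool (e2 = 1) + (of_bool (e3 = -1) :: nat)"
      by (rule iseq_equivD[OF A B])
    \<comment> \<open>The value 3 is the maximum of this sum, so both indicators are 1.\<close>
    have e: "e2 = 1" "e3 = -1" using n by (auto split: if_splits simp: of_bool_def)
    show ?thesis
    proof (cases s)
      case True
      \<comment> \<open>For sign 1 the positive coefficient in the solved second equation belongs to
        the root \<open>c\<close>. The exchange makes it the third coordinate, as
        \<open>figure_eight\<close> expects; for sign -1 this already holds.\<close>
      have can': "canon211 (\<alpha> \<cdot>\<^sub>m A + \<beta> \<cdot>\<^sub>m B) (\<gamma> \<cdot>\<^sub>m A + \<delta> \<cdot>\<^sub>m B) a c b 1 (-1) 1"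
      proof (rule canon211_swap)
        show "\<alpha> \<cdot>\<^sub>m A + \<beta> \<cdot>\<^sub>m B \<in> carrier_mat 4 4" "\<gamma> \<cdot>\<^sub>m A + \<delta> \<cdot>\<^sub>m B \<in> carrier_mat 4 4"
          using A(1) B(1) by simp_all
        show "canon211 (\<alpha> \<cdot>\<^sub>m A + \<beta> \<cdot>\<^sub>m B) (\<gamma> \<cdot>\<^sub>m A + \<delta> \<cdot>\<^sub>m B) a b c 1 1 (-1)"
          using can unfolding e by (simp only: True if_True)
      qed
      obtain Q \<mu> \<nu> where F: "frame Q"
        and Z: "\<forall>x. (qf A (lin Q x) = 0 \<and> qf B (lin Q x) = 0) \<longleftrightarrow>
          2 * 1 * x $ 0 * x $ 1 + (-1) * (x $ 2)\<^sup>2 + 1 * (x $ 3)\<^sup>2 = 0 \<and>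
          1 * (x $ 1)\<^sup>2 + (-1) * (c - a) * (x $ 2)\<^sup>2 + 1 * (b - a) * (x $ 3)\<^sup>2 = 0"
        and sing: "(\<mu>, \<nu>) \<noteq> (0, 0)" "lin (\<mu> \<cdot>\<^sub>m A + \<nu> \<cdot>\<^sub>m B) (lin Q (vec4 1 0 0 0)) = 0"
        using canon211_frame[OF A(1) B(1) D can'] by (elim exE conjE)
      show ?thesis
        by (rule frame.figure_eight[OF F A(1) B(1) _ _ _ _ sing, of "c - a" "b - a"])
          (use abc in \<open>auto simp: Z algebra_simps\<close>)
    next
      case False
      have can': "canon211 (\<alpha> \<cdot>\<^sub>m A + \<beta> \<cdot>\<^sub>m B) (\<gamma> \<cdot>\<^sub>m A + \<delta> \<cdot>\<^sub>m B) a b c (-1) 1 (-1)"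
        using can unfolding e by (simp only: False if_False)
      obtain Q \<mu> \<nu> where F: "frame Q"
        and Z: "\<forall>x. (qf A (lin Q x) = 0 \<and> qf B (lin Q x) = 0) \<longleftrightarrow>
          2 * (-1) * x $ 0 * x $ 1 + 1 * (x $ 2)\<^sup>2 + (-1) * (x $ 3)\<^sup>2 = 0 \<and>
          (-1) * (x $ 1)\<^sup>2 + 1 * (b - a) * (x $ 2)\<^sup>2 + (-1) * (c - a) * (x $ 3)\<^sup>2 = 0"
        and sing: "(\<mu>, \<nu>) \<noteq> (0, 0)" "lin (\<mu> \<cdot>\<^sub>m A + \<nu> \<cdot>\<^sub>m B) (lin Q (vec4 1 0 0 0)) = 0"
        using canon211_frame[OF A(1) B(1) D can'] by (elim exE conjE)
      show ?thesis
        by (rule frame.figure_eight[OF F A(1) B(1) _ _ _ _ sing, of "b - a" "c - a"])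
          (use abc in \<open>auto simp: Z algebra_simps\<close>)
    qed
  qed
  \<comment> \<open>Here \<open>e2 = e3 = 1\<close> whatever the subscript, so both cases share
    these equations and differ only in \<open>e\<close>: with -1 the second is a cone over an
    ellipse, with 1 it is definite.\<close>
  have S11: "\<exists>Q \<mu> \<nu> P R. frame Q \<and> P > 0 \<and> R > 0 \<and>
      (\<forall>x. (qf A (lin Q x) = 0 \<and> qf B (lin Q x) = 0) \<longleftrightarrow>
          2 * e * x $ 0 * x $ 1 + (x $ 2)\<^sup>2 + (x $ 3)\<^sup>2 = 0 \<and>
          e * (x $ 1)\<^sup>2 + P * (x $ 2)\<^sup>2 + R * (x $ 3)\<^sup>2 = 0) \<and>
      (\<mu>, \<nu>) \<noteq> (0, 0) \<and> lin (\<mu> \<cdot>\<^sub>m A + \<nu> \<cdot>\<^sub>m B) (lin Q (vec4 1 0 0 0)) = 0"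
    if iseq: "iseq_equiv A B (1, [([Wr s, Wr s], 1), ([Bar], 2), ([Bar], 3)])"
      and es: "e = (if s then 1 else -1)" for s and e :: real
  proof -
    from iseq obtain \<alpha> \<beta> \<gamma> \<delta> a b c e2 e3 where D: "\<alpha> * \<delta> - \<beta> * \<gamma> \<noteq> 0" and abc: "a < b" "b < c"
      and can: "canon211 (\<alpha> \<cdot>\<^sub>m A + \<beta> \<cdot>\<^sub>m B) (\<gamma> \<cdot>\<^sub>m A + \<delta> \<cdot>\<^sub>m B) a b c (if s then 1 else -1) e2 e3"
      and n: "3 = 1 + of_bool (e2 = 1) + (of_bool (e3 = 1) :: nat)"
      by (rule iseq_equivD[OF A B])
    have e: "e2 = 1" "e3 = 1" using n by (auto split: if_splits simp: of_bool_def)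
    obtain Q \<mu> \<nu> where F: "frame Q"
      and Z: "\<forall>x. (qf A (lin Q x) = 0 \<and> qf B (lin Q x) = 0) \<longleftrightarrow>
        2 * e * x $ 0 * x $ 1 + 1 * (x $ 2)\<^sup>2 + 1 * (x $ 3)\<^sup>2 = 0 \<and>
        e * (x $ 1)\<^sup>2 + 1 * (b - a) * (x $ 2)\<^sup>2 + 1 * (c - a) * (x $ 3)\<^sup>2 = 0"
      and sing: "(\<mu>, \<nu>) \<noteq> (0, 0)" "lin (\<mu> \<cdot>\<^sub>m A + \<nu> \<cdot>\<^sub>m B) (lin Q (vec4 1 0 0 0)) = 0"
      using canon211_frame[OF A(1) B(1) D can[folded es, unfolded e]] by (elim exE conjE)
    show ?thesis
      using F Z sing abc
      by (intro exI[of _ Q] exI[of _ \<mu>] exI[of _ \<nu>] exI[of _ "b - a"] exI[of _ "c - a"]) simp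
  qed
  show "\<exists>C p. proj_components A B = {C, {p, -p}} \<and> C \<noteq> {p, -p} \<and>
                 closed_comp C \<and> \<not> (\<exists>q. C = {q, -q}) \<and> acnode A B p"
    if iseq: "iseq_equiv A B S_11m"
  proof -
    have e: "-1 = (if False then 1 else -1 :: real)" by simp
    obtain Q \<mu> \<nu> P R where F: "frame Q" and P: "P > 0" "R > 0"
      and Z: "\<forall>x. (qf A (lin Q x) = 0 \<and> qf B (lin Q x) = 0) \<longleftrightarrow>
          2 * (-1) * x $ 0 * x $ 1 + (x $ 2)\<^sup>2 + (x $ 3)\<^sup>2 = 0 \<and>
          (-1) * (x $ 1)\<^sup>2 + P * (x $ 2)\<^sup>2 + R * (x $ 3)\<^sup>2 = 0"
      and sing: "(\<mu>, \<nu>) \<noteq> (0, 0)" "lin (\<mu> \<cdot>\<^sub>m A + \<nu> \<cdot>\<^sub>m B) (lin Q (vec4 1 0 0 0)) = 0"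
      using S11[OF iseq[unfolded S_11m_def] e] by (elim exE conjE)
    show ?thesis
      by (rule frame.oval_and_acnode[OF F A(1) B(1) _ P sing]) (auto simp: Z)
  qed
  show "\<exists>p. qsic_sph A B = {p, -p} \<and> acnode A B p" if iseq: "iseq_equiv A B S_11p"
  proof -
    have e: "1 = (if True then 1 else -1 :: real)" by simp
    obtain Q \<mu> \<nu> P R where F: "frame Q" and P: "P > 0" "R > 0"
      and Z: "\<forall>x. (qf A (lin Q x) = 0 \<and> qf B (lin Q x) = 0) \<longleftrightarrow>
          2 * 1 * x $ 0 * x $ 1 + (x $ 2)\<^sup>2 + (x $ 3)\<^sup>2 = 0 \<and>
          1 * (x $ 1)\<^sup>2 + P * (x $ 2)\<^sup>2 + R * (x $ 3)\<^sup>2 = 0"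
      and sing: "(\<mu>, \<nu>) \<noteq> (0, 0)" "lin (\<mu> \<cdot>\<^sub>m A + \<nu> \<cdot>\<^sub>m B) (lin Q (vec4 1 0 0 0)) = 0"
      using S11[OF iseq[unfolded S_11p_def] e] by (elim exE conjE)
    show ?thesis
      by (rule frame.one_point[OF F A(1) B(1) _ P sing]) (simp add: Z)
  qed
qed

end
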